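(* There exist an ergodic Liouville vector $\tau\in\mathbb R^2$, a continuous unitary sewing system $(U_1,U_2)$ with values in $U(2)$ whose bundle $V\to\mathbb T^2$ has $c_1(V)[\mathbb T^2]=1$, and a strip-admissible analytic cocycle $A$ with values in $GL(2,\mathbb C)$ over $Sw=w+\tau$ admitting a dominated splitting $E^s\oplus E^u$, such that the line $L=E^u$ has charge $m(L)=0$ and multiplier winding vector $k(L)=0$ and satisfies the phase-coboundary hypothesis (H2), yet $L$ carries no nonzero measurable eigensection.
   Context: Notation. $\mathbb T^2=\mathbb R^2/\mathbb Z^2$, $w=(w_1,w_2)$, Haar probability measure $\mu$, orientation $dw_1\wedge dw_2$; $e_1=(1,0)$, $e_2=(0,1)$; $\langle h\rangle=\int_{\mathbb T^2}h\,d\mu$; the inner product on $\mathbb C^2$ is conjugate-linear in the first slot; $\tau=(\alpha,\beta)\in\mathbb R^2$, $Sw=w+\tau$. Ergodic means $1,\alpha,\beta$ rationally independent over $\mathbb Q$. Chern classes are normalized by $c_1(\nabla)=\frac{\mathrm i}{2\pi}F_\nabla$. Liouville: $\tau$ satisfies the Diophantine condition $\mathrm{DC}(c,\nu)$ for no $c>0,\nu\ge1$, where $\mathrm{DC}(c,\nu)$ means $\|\nu_1'\alpha+\nu_2'\beta\|_{\mathbb R/\mathbb Z}\ge c\,(|\nu_1'|+|\nu_2'|)^{-\nu}$ for all $(\nu_1',\nu_2')\in\mathbb Z^2\setminus\{0\}$ ($\|x\|_{\mathbb R/\mathbb Z}$ the distance to the nearest integer). Sewing system and cocycle. A continuous unitary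 sewing system is a pair of continuous $U_1,U_2\colon\mathbb R^2\to U(2)$ with (K1) $U_1(w+e_2)U_2(w)=U_2(w+e_1)U_1(w)$; it presents the rank-two Hermitian bundle $V\to\mathbb T^2$ given as the quotient of $\mathbb R^2\times\mathbb C^2$ by the action generated by $(w,\xi)\mapsto(w+e_j,U_j(w)\xi)$. Measurable sections of $V$ are measurable $F\colon\mathbb R^2\to\mathbb C^2$ with $F(w+e_j)=U_j(w)F(w)$ a.e. An equivariant cocycle is a continuous $A\colon\mathbb R^2\to GL(2,\mathbb C)$ with (K2) $A(w+e_j)U_j(w)=U_j(Sw)A(w)$. A measurable eigensection is a measurable section, not a.e. zero, with $A(w)F(w)=\lambda F(Sw)$ a.e. for some $\lambda\in\mathbb C$. Strip-admissible. For $\delta>0$ let $\Omega_\delta=\{w\in\mathbb C^2:|\operatorname{Im}w_1|\le\delta,|\operatorname{Im}w_2|\le\delta\}$. $(U_1,U_2,A)$ is strip-admissible if for some $\delta_0>0$ the maps $U_1,U_2,A$ extend to matrix functions holomorphic on an open neighborhood of $\Omega_{\delta_0}$ and bounded on $\Omega_{\delta_0}$, with $U_j(w)$ unitary and $\det A(w)\ne0$ for real $w$, and (K1), (K2) holding on $\mathbb R^2$. Invariant line. A continuous map $\ell\colon\mathbb R^2\to\mathbb{CP}^1$ with $\ell(w+e_j)=U_j(w)\ell(w)$ and $A(w)\ell(w)=\ell(Sw)$ for all $w$; it induces a line subbundle $L\subset V$. $F$ is carried by $L$ if $F(w)\in\ell(w)$ a.e. Dominated splitting. A pair of invariant lines $\ell_s,\ell_u$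 with $\ell_s(w)\ne\ell_u(w)$ for all $w$, inducing $E^s,E^u$ with $V=E^s\oplus E^u$, such that for some integer $N\ge1$ and $0<\kappa_0<1$, $\|A^{(N)}(z)|_{\ell_s(z)}\|/\mathfrak m(A^{(N)}(z)|_{\ell_u(z)})\le\kappa_0^2$ for all $z\in\mathbb R^2$, where $A^{(N)}(w)=A(S^{N-1}w)\cdots A(w)$ and $\mathfrak m(M)=\min_{|v|=1}|Mv|$. Charge, winding, (H2). For an invariant line $\ell$ there are a continuous $e\colon\mathbb R^2\to\mathbb C^2$ with $|e|=1$, $e(w)\in\ell(w)$, and a unique integer $m=m(L)$ (the charge) with $e(w+e_1)=U_1(w)e(w)$, $e(w+e_2)=\mathrm e^{2\pi\mathrm i m w_1}U_2(w)e(w)$. The multiplier is $q(w)=\langle e(Sw),A(w)e(w)\rangle$ (continuous, zero-free); $p(w)=\frac{q(w)}{|q(w)|}\mathrm e^{2\pi\mathrm i m\alpha w_2}$ is continuous, $\mathbb Z^2$-periodic, unimodular; $k=k(L)\in\mathbb Z^2$ is its winding vector and $g\colon\mathbb T^2\to\mathbb R$ is continuous with $p(w)=\mathrm e^{2\pi\mathrm i(k\cdot w+g(w))}$. Hypothesis (H2): there is a measurable $v\colon\mathbb T^2\to\mathbb R$ with $v(w)-v(Sw)=g(w)-\langle g\rangle$ a.e. Neither $k$ nor the validity of (H2) depends on the choice of $e$. *)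

theory Defs
  imports "HOL-Analysis.Analysis"
begin

text \<open>
  Points of \<open>\<real>\<^sup>2\<close> are pairs, so that \<open>e\<^sub>1 = (1,0)\<close> and \<open>e\<^sub>2 = (0,1)\<close>, and functions on the torus
  are \<open>\<int>\<^sup>2\<close>-periodic functions on \<open>\<real>\<^sup>2\<close>.  Fibre vectors and matrices have type
  \<^typ>\<open>complex^2\<close> and \<^typ>\<open>complex^2^2\<close>; the library norm on \<^typ>\<open>complex^2\<close> is the Hermitian one.
\<close>

subsection \<open>The torus and the translation\<close>

abbreviation e1 :: "real \<times> real" where "e1 \<equiv> (1, 0)"
abbreviation e2 :: "real \<times> real" where "e2 \<equiv> (0, 1)"

definition periodic2 :: "(real \<times> real \<Rightarrow> 'a) \<Rightarrow> bool" where
  "periodic2 h \<longleftrightarrow> (\<forall>w. h (w + e1) = h w \<and> h (w + e2) = h w)"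

definition torus_mean :: "(real \<times> real \<Rightarrow> 'a::real_normed_vector) \<Rightarrow> 'a" where
  "torus_mean h = integral (cbox (0, 0) (1, 1)) h"

definition ergodic_vector :: "real \<times> real \<Rightarrow> bool" where
  "ergodic_vector \<tau> \<longleftrightarrow>
     (\<forall>a\<in>\<rat>. \<forall>b\<in>\<rat>. \<forall>c\<in>\<rat>. a + b * fst \<tau> + c * snd \<tau> = 0 \<longrightarrow> a = 0 \<and> b = 0 \<and> c = 0)"

definition dist_to_int :: "real \<Rightarrow> real" where
  "dist_to_int x = infdist x \<int>"

definition diophantine :: "real \<Rightarrow> real \<Rightarrow> real \<times> real \<Rightarrow> bool" where
  "diophantine c \<nu> \<tau> \<longleftrightarrow>
     (\<forall>(n1::int) (n2::int). (n1, n2) \<noteq> (0, 0) \<longrightarrow>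
        dist_to_int (of_int n1 * fst \<tau> + of_int n2 * snd \<tau>)
          \<ge> c * of_int (\<bar>n1\<bar> + \<bar>n2\<bar>) powr (- \<nu>))"

definition liouville_vector :: "real \<times> real \<Rightarrow> bool" where
  "liouville_vector \<tau> \<longleftrightarrow> \<not> (\<exists>c>0. \<exists>\<nu>\<ge>1. diophantine c \<nu> \<tau>)"

subsection \<open>Sewing systems and cocycles\<close>

definition adjoint_mat :: "complex^2^2 \<Rightarrow> complex^2^2" where
  "adjoint_mat M = (\<chi> i j. cnj (M $ j $ i))"

definition unitary_mat :: "complex^2^2 \<Rightarrow> bool" where
  "unitary_mat M \<longleftrightarrow> adjoint_mat M ** M = mat 1 \<and> M ** adjoint_mat M = mat 1"

definition K1 :: "(real \<times> real \<Rightarrow> complex^2^2) \<Rightarrow> (real \<times> real \<Rightarrow> complex^2^2) \<Rightarrow> bool" where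
  "K1 U1 U2 \<longleftrightarrow> (\<forall>w. U1 (w + e2) ** U2 w = U2 (w + e1) ** U1 w)"

definition K2 :: "real \<times> real \<Rightarrow> (real \<times> real \<Rightarrow> complex^2^2) \<Rightarrow> (real \<times> real \<Rightarrow> complex^2^2) \<Rightarrow>
    (real \<times> real \<Rightarrow> complex^2^2) \<Rightarrow> bool" where
  "K2 \<tau> U1 U2 A \<longleftrightarrow>
     (\<forall>w. A (w + e1) ** U1 w = U1 (w + \<tau>) ** A w \<and> A (w + e2) ** U2 w = U2 (w + \<tau>) ** A w)"

definition sewing_system ::
    "(real \<times> real \<Rightarrow> complex^2^2) \<Rightarrow> (real \<times> real \<Rightarrow> complex^2^2) \<Rightarrow> bool" where
  "sewing_system U1 U2 \<longleftrightarrow>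
     continuous_on UNIV U1 \<and> continuous_on UNIV U2 \<and>
     (\<forall>w. unitary_mat (U1 w) \<and> unitary_mat (U2 w)) \<and> K1 U1 U2"

definition equivariant_cocycle :: "real \<times> real \<Rightarrow> (real \<times> real \<Rightarrow> complex^2^2) \<Rightarrow>
    (real \<times> real \<Rightarrow> complex^2^2) \<Rightarrow> (real \<times> real \<Rightarrow> complex^2^2) \<Rightarrow> bool" where
  "equivariant_cocycle \<tau> U1 U2 A \<longleftrightarrow>
     continuous_on UNIV A \<and> (\<forall>w. det (A w) \<noteq> 0) \<and> K2 \<tau> U1 U2 A"

definition measurable_section :: "(real \<times> real \<Rightarrow> complex^2^2) \<Rightarrow>
    (real \<times> real \<Rightarrow> complex^2^2) \<Rightarrow> (real \<times> real \<Rightarrow> complex^2) \<Rightarrow> bool" where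
  "measurable_section U1 U2 F \<longleftrightarrow>
     F \<in> borel_measurable lebesgue \<and>
     (AE w in lebesgue. F (w + e1) = U1 w *v F w) \<and>
     (AE w in lebesgue. F (w + e2) = U2 w *v F w)"

definition measurable_eigensection :: "real \<times> real \<Rightarrow> (real \<times> real \<Rightarrow> complex^2^2) \<Rightarrow>
    (real \<times> real \<Rightarrow> complex^2^2) \<Rightarrow> (real \<times> real \<Rightarrow> complex^2^2) \<Rightarrow>
    (real \<times> real \<Rightarrow> complex^2) \<Rightarrow> bool" where
  "measurable_eigensection \<tau> U1 U2 A F \<longleftrightarrow>
     measurable_section U1 U2 F \<and> \<not> (AE w in lebesgue. F w = 0) \<and>
     (\<exists>c::complex. AE w in lebesgue. A w *v F w = c *s F (w + \<tau>))"

subsection \<open>Strip-admissibility\<close>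

definition strip :: "real \<Rightarrow> (complex \<times> complex) set" where
  "strip \<delta> = {z. \<bar>Im (fst z)\<bar> \<le> \<delta> \<and> \<bar>Im (snd z)\<bar> \<le> \<delta>}"

text \<open>Holomorphy in two variables: complex Fr\'echet differentiability.\<close>

definition holomorphic2_on ::
    "(complex \<times> complex \<Rightarrow> complex) \<Rightarrow> (complex \<times> complex) set \<Rightarrow> bool" where
  "holomorphic2_on f S \<longleftrightarrow>
     (\<forall>z\<in>S. \<exists>a b. (f has_derivative (\<lambda>h. a * fst h + b * snd h)) (at z))"

definition strip_extends :: "real \<Rightarrow> (real \<times> real \<Rightarrow> complex^2^2) \<Rightarrow> bool" where
  "strip_extends \<delta> M \<longleftrightarrow>
     (\<exists>M' W. open W \<and> strip \<delta> \<subseteq> W \<and> (\<forall>i j. holomorphic2_on (\<lambda>z. M' z $ i $ j) W) \<and>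
        bounded (M' ` strip \<delta>) \<and> (\<forall>x y. M' (of_real x, of_real y) = M (x, y)))"

definition strip_admissible :: "real \<times> real \<Rightarrow> (real \<times> real \<Rightarrow> complex^2^2) \<Rightarrow>
    (real \<times> real \<Rightarrow> complex^2^2) \<Rightarrow> (real \<times> real \<Rightarrow> complex^2^2) \<Rightarrow> bool" where
  "strip_admissible \<tau> U1 U2 A \<longleftrightarrow>
     (\<exists>\<delta>>0. strip_extends \<delta> U1 \<and> strip_extends \<delta> U2 \<and> strip_extends \<delta> A) \<and>
     (\<forall>w. unitary_mat (U1 w) \<and> unitary_mat (U2 w) \<and> det (A w) \<noteq> 0) \<and>
     K1 U1 U2 \<and> K2 \<tau> U1 U2 A"

subsection \<open>The first Chern number\<close>

definition partial1 :: "(real \<times> real \<Rightarrow> 'a::real_normed_vector) \<Rightarrow> real \<times> real \<Rightarrow> 'a" where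
  "partial1 f w = frechet_derivative f (at w) e1"

definition partial2 :: "(real \<times> real \<Rightarrow> 'a::real_normed_vector) \<Rightarrow> real \<times> real \<Rightarrow> 'a" where
  "partial2 f w = frechet_derivative f (at w) e2"

definition C1_on_plane :: "(real \<times> real \<Rightarrow> 'a::real_normed_vector) \<Rightarrow> bool" where
  "C1_on_plane f \<longleftrightarrow> f differentiable_on UNIV \<and>
     continuous_on UNIV (partial1 f) \<and> continuous_on UNIV (partial2 f)"

text \<open>
  A connection \<open>\<nabla> = d + a\<^sub>1 dw\<^sub>1 + a\<^sub>2 dw\<^sub>2\<close> on \<open>\<real>\<^sup>2 \<times> \<complex>\<^sup>2\<close> descends to the bundle presented by
  \<open>(U\<^sub>1, U\<^sub>2)\<close> iff \<open>(\<nabla>F)(w + e\<^sub>j) = U\<^sub>j(w) (\<nabla>F)(w)\<close> for all smooth sections \<open>F\<close>, which says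
  \<open>a\<^sub>i(w + e\<^sub>j) U\<^sub>j(w) = U\<^sub>j(w) a\<^sub>i(w) - \<partial>\<^sub>i U\<^sub>j(w)\<close>.
\<close>

definition descends_along :: "real \<times> real \<Rightarrow> (real \<times> real \<Rightarrow> complex^2^2) \<Rightarrow>
    (real \<times> real \<Rightarrow> complex^2^2) \<Rightarrow> (real \<times> real \<Rightarrow> complex^2^2) \<Rightarrow> bool" where
  "descends_along e U a1 a2 \<longleftrightarrow>
     (\<forall>w. a1 (w + e) ** U w = U w ** a1 w - partial1 U w \<and>
          a2 (w + e) ** U w = U w ** a2 w - partial2 U w)"

definition connection_form :: "(real \<times> real \<Rightarrow> complex^2^2) \<Rightarrow> (real \<times> real \<Rightarrow> complex^2^2) \<Rightarrow>
    (real \<times> real \<Rightarrow> complex^2^2) \<Rightarrow> (real \<times> real \<Rightarrow> complex^2^2) \<Rightarrow> bool" where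
  "connection_form U1 U2 a1 a2 \<longleftrightarrow>
     C1_on_plane a1 \<and> C1_on_plane a2 \<and>
     descends_along e1 U1 a1 a2 \<and> descends_along e2 U2 a1 a2"

text \<open>The coefficient of \<open>dw\<^sub>1 \<and> dw\<^sub>2\<close> in \<open>F\<^sub>\<nabla> = da + a \<and> a\<close>.\<close>

definition curvature :: "(real \<times> real \<Rightarrow> complex^2^2) \<Rightarrow> (real \<times> real \<Rightarrow> complex^2^2) \<Rightarrow>
    real \<times> real \<Rightarrow> complex^2^2" where
  "curvature a1 a2 w = partial1 a2 w - partial2 a1 w + a1 w ** a2 w - a2 w ** a1 w"

text \<open>
  Chern--Weil with \<open>c\<^sub>1(\<nabla>) = (\<i>/2\<pi>) tr F\<^sub>\<nabla>\<close>; for continuously differentiable sewing maps.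
  The value does not depend on the connection, see \<open>has_chern_number_unique\<close> below.
\<close>

definition has_chern_number ::
    "(real \<times> real \<Rightarrow> complex^2^2) \<Rightarrow> (real \<times> real \<Rightarrow> complex^2^2) \<Rightarrow> int \<Rightarrow> bool" where
  "has_chern_number U1 U2 n \<longleftrightarrow>
     C1_on_plane U1 \<and> C1_on_plane U2 \<and>
     (\<exists>a1 a2. connection_form U1 U2 a1 a2 \<and>
        of_int n = (\<i> / (2 * of_real pi)) * torus_mean (\<lambda>w. trace (curvature a1 a2 w)))"

lemma torus_mean_partial:
  fixes b :: "real \<times> real \<Rightarrow> complex"
  assumes "C1_on_plane b" "periodic2 b"
  shows "torus_mean (partial1 b) = 0" "torus_mean (partial2 b) = 0"
proof -
  have d: "(b has_derivative frechet_derivative b (at w)) (at w)" for w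
    using assms(1) unfolding C1_on_plane_def differentiable_on_def frechet_derivative_works [symmetric]
    by blast
  have c: "continuous_on UNIV (partial1 b)" "continuous_on UNIV (partial2 b)"
    using assms(1) by (auto simp: C1_on_plane_def)
  have p: "b (1, y) = b (0, y)" "b (x, 1) = b (x, 0)" for x y
    using assms(2) [unfolded periodic2_def, rule_format, of "(0, y)"]
      assms(2) [unfolded periodic2_def, rule_format, of "(x, 0)"] by simp_all
  have scale: "frechet_derivative b (at w) (t *\<^sub>R v) = t *\<^sub>R frechet_derivative b (at w) v" for w v t
    by (rule linear_scale [OF has_derivative_linear [OF d]])
  have 1: "((\<lambda>x. b (x, y)) has_vector_derivative partial1 b (x, y)) (at x within S)" for x y S
  proof -
    have "((\<lambda>x. (x, y)) has_derivative (\<lambda>h. (h, 0))) (at x within S)"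
      by (auto intro!: derivative_eq_intros)
    from has_derivative_compose[OF this d]
    have "((\<lambda>x. b (x, y)) has_derivative (\<lambda>h. frechet_derivative b (at (x, y)) (h, 0))) (at x within S)" .
    moreover have "frechet_derivative b (at (x, y)) (h, 0) = h *\<^sub>R partial1 b (x, y)" for h
      using scale [of "(x, y)" h "(1,0)"] by (simp add: partial1_def)
    ultimately show ?thesis by (simp add: has_vector_derivative_def)
  qed
  have 2: "((\<lambda>y. b (x, y)) has_vector_derivative partial2 b (x, y)) (at y within S)" for x y S
  proof -
    have "((\<lambda>y. (x, y)) has_derivative (\<lambda>h. (0, h))) (at y within S)"
      by (auto intro!: derivative_eq_intros)
    from has_derivative_compose[OF this d]
    have "((\<lambda>y. b (x, y)) has_derivative (\<lambda>h. frechet_derivative b (at (x, y)) (0, h))) (at y within S)" .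
    moreover have "frechet_derivative b (at (x, y)) (0, h) = h *\<^sub>R partial2 b (x, y)" for h
      using scale [of "(x, y)" h "(0,1)"] by (simp add: partial2_def)
    ultimately show ?thesis by (simp add: has_vector_derivative_def)
  qed
  have i1: "integral (cbox 0 1) (\<lambda>x. partial1 b (x, y)) = 0" for y
    using fundamental_theorem_of_calculus[OF _ 1, of 0 1 y] p by (simp add: integral_unique)
  have i2: "integral (cbox 0 1) (\<lambda>y. partial2 b (x, y)) = 0" for x
    using fundamental_theorem_of_calculus[OF _ 2, of 0 1 x] p by (simp add: integral_unique)
  have c': "continuous_on (cbox (0,0) (1,1)) (partial1 b)" "continuous_on (cbox (0,0) (1,1)) (partial2 b)"
    using c continuous_on_subset by blast+
  have "integral (cbox 0 1) (\<lambda>x. integral (cbox 0 1) (\<lambda>y. partial1 b (x, y)))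
      = integral (cbox 0 1) (\<lambda>y. integral (cbox 0 1) (\<lambda>x. partial1 b (x, y)))"
    using integral_swap_continuous[of 0 0 1 1 "\<lambda>x y. partial1 b (x, y)"] c' by simp
  then show "torus_mean (partial1 b) = 0"
    unfolding torus_mean_def using integral_prod_continuous[OF c'(1)] i1 by simp
  show "torus_mean (partial2 b) = 0"
    unfolding torus_mean_def using integral_prod_continuous[OF c'(2)] i2 by simp
qed

lemma has_chern_number_unique:
  assumes inv: "\<And>w. invertible (U1 w)" "\<And>w. invertible (U2 w)"
    and m: "has_chern_number U1 U2 m" and n: "has_chern_number U1 U2 n"
  shows "m = n"
proof -
  obtain a1 a2 where a: "connection_form U1 U2 a1 a2"
    "of_int m = (\<i> / (2 * of_real pi)) * torus_mean (\<lambda>w. trace (curvature a1 a2 w))"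
    using m unfolding has_chern_number_def by blast
  obtain c1 c2 where c: "connection_form U1 U2 c1 c2"
    "of_int n = (\<i> / (2 * of_real pi)) * torus_mean (\<lambda>w. trace (curvature c1 c2 w))"
    using n unfolding has_chern_number_def by blast
  define b1 where "b1 w = trace (a1 w - c1 w)" for w
  define b2 where "b2 w = trace (a2 w - c2 w)" for w
  have similar: "trace X = trace Y" if XY: "X ** U = U ** Y" and U: "invertible U" for X Y U :: "complex^2^2"
  proof -
    obtain V where V: "U ** V = mat 1" "V ** U = mat 1"
      using U unfolding invertible_def by blast
    have "X = X ** (U ** V)" by (simp add: V)
    also have "\<dots> = (U ** Y) ** V" by (simp only: matrix_mul_assoc XY)
    finally have "trace X = trace (V ** (U ** Y))" by (metis trace_mul_sym)
    also have "V ** (U ** Y) = Y" by (simp add: matrix_mul_assoc V)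
    finally show ?thesis .
  qed
  have D: "(a - c) ** U = U ** (a' - c')" if "a ** U = U ** a' - P" "c ** U = U ** c' - P"
    for a c a' c' U P :: "complex^2^2"
  proof -
    have "(a - c) ** U = a ** U - c ** U" "U ** (a' - c') = U ** a' - U ** c'"
      by (simp_all add: matrix_matrix_mult_def vec_eq_iff sum_subtractf algebra_simps)
    then show ?thesis using that by simp
  qed
  have des: "descends_along e1 U1 a1 a2" "descends_along e2 U2 a1 a2"
    "descends_along e1 U1 c1 c2" "descends_along e2 U2 c1 c2"
    using a(1) c(1) by (simp_all add: connection_form_def)
  have step: "b1 (w + e) = b1 w \<and> b2 (w + e) = b2 w"
    if da: "descends_along e U a1 a2" and dc: "descends_along e U c1 c2" and U: "invertible (U w)"
    for e U w
    using da [unfolded descends_along_def, rule_format, of w]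
      dc [unfolded descends_along_def, rule_format, of w]
    unfolding b1_def b2_def by (intro conjI similar [OF D U]) auto
  have per: "periodic2 b1" "periodic2 b2"
    unfolding periodic2_def
    using step [OF des(1,3) inv(1)] step [OF des(2,4) inv(2)] by blast+
  have bl: "bounded_linear (trace :: complex^2^2 \<Rightarrow> complex)"
    unfolding linear_conv_bounded_linear [symmetric]
    by (rule linearI) (simp_all add: trace_def sum.distrib scaleR_sum_right)
  have key: "C1_on_plane (\<lambda>w. trace (f w - g w)) \<and>
      (\<forall>w. partial1 (\<lambda>w. trace (f w - g w)) w = trace (partial1 f w) - trace (partial1 g w)) \<and>
      (\<forall>w. partial2 (\<lambda>w. trace (f w - g w)) w = trace (partial2 f w) - trace (partial2 g w))"
    if "C1_on_plane f" "C1_on_plane g" for f g :: "real \<times> real \<Rightarrow> complex^2^2"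
  proof -
    have fd: "(f has_derivative frechet_derivative f (at w)) (at w)"
         "(g has_derivative frechet_derivative g (at w)) (at w)" for w
      using that unfolding C1_on_plane_def differentiable_on_def frechet_derivative_works [symmetric]
      by blast+
    have hd: "((\<lambda>w. trace (f w - g w)) has_derivative
       (\<lambda>h. trace (frechet_derivative f (at w) h - frechet_derivative g (at w) h))) (at w)" for w
      by (rule bounded_linear.has_derivative [OF bl has_derivative_diff [OF fd]])
    have fr: "frechet_derivative (\<lambda>w. trace (f w - g w)) (at w) h
        = trace (frechet_derivative f (at w) h) - trace (frechet_derivative g (at w) h)" for w h
      unfolding frechet_derivative_at [OF hd, symmetric] by (rule trace_sub)
    have "continuous_on UNIV (\<lambda>w. trace (partial1 f w))" "continuous_on UNIV (\<lambda>w. trace (partial1 g w))"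
         "continuous_on UNIV (\<lambda>w. trace (partial2 f w))" "continuous_on UNIV (\<lambda>w. trace (partial2 g w))"
      using that bounded_linear.continuous_on [OF bl] by (auto simp: C1_on_plane_def)
    then show ?thesis
      using hd unfolding C1_on_plane_def partial1_def partial2_def fr
        differentiable_on_def differentiable_def
      by (intro conjI ballI allI continuous_on_diff) blast+
  qed
  have C: "C1_on_plane a1" "C1_on_plane a2" "C1_on_plane c1" "C1_on_plane c2"
    using a(1) c(1) by (auto simp: connection_form_def)
  note k1 = key [OF C(1,3), folded b1_def] and k2 = key [OF C(2,4), folded b2_def]
  have tr: "trace (curvature x y w) = trace (partial1 y w) - trace (partial2 x w)" for x y w
    by (simp add: curvature_def trace_add trace_sub trace_mul_sym [of "x w"])
  have int: "(\<lambda>w. trace (curvature x y w)) integrable_on cbox (0,0) (1,1)"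
    if "C1_on_plane x" "C1_on_plane y" for x y
  proof (rule integrable_continuous)
    have "continuous_on UNIV (\<lambda>w. trace (curvature x y w))"
      unfolding tr using that bounded_linear.continuous_on [OF bl]
      by (auto simp: C1_on_plane_def intro!: continuous_intros)
    then show "continuous_on (cbox (0,0) (1,1)) (\<lambda>w. trace (curvature x y w))"
      using continuous_on_subset by blast
  qed
  have ib: "partial1 b2 integrable_on cbox (0,0) (1,1)" "partial2 b1 integrable_on cbox (0,0) (1,1)"
    using k1 k2 by (auto simp: C1_on_plane_def intro!: integrable_continuous
        elim: continuous_on_subset)
  have "torus_mean (\<lambda>w. trace (curvature a1 a2 w)) - torus_mean (\<lambda>w. trace (curvature c1 c2 w))
      = integral (cbox (0,0) (1,1)) (\<lambda>w. trace (curvature a1 a2 w) - trace (curvature c1 c2 w))"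
    unfolding torus_mean_def by (rule integral_diff [symmetric]; rule int; fact C)
  also have "\<dots> = integral (cbox (0,0) (1,1)) (\<lambda>w. partial1 b2 w - partial2 b1 w)"
    using k1 k2 by (intro integral_cong) (simp add: tr del: split_paired_All)
  also have "\<dots> = torus_mean (partial1 b2) - torus_mean (partial2 b1)"
    unfolding torus_mean_def by (rule integral_diff [OF ib])
  also have "\<dots> = 0"
    using torus_mean_partial per k1 k2 by simp
  finally have "(of_int m :: complex) = of_int n"
    using a(2) c(2) by simp
  then show ?thesis by simp
qed

subsection \<open>Invariant lines and dominated splittings\<close>

text \<open>
  \<open>\<complex>\<P>\<^sup>1\<close> is the set of lines \<^term>\<open>vec.span {v}\<close>, \<^prop>\<open>v \<noteq> 0\<close>, in \<^typ>\<open>complex^2\<close>, with the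
  quotient topology from \<open>\<complex>\<^sup>2 - {0}\<close>.
\<close>

definition CP1 :: "(complex^2) set topology" where
  "CP1 = topology (\<lambda>T. T \<subseteq> (\<lambda>v. vec.span {v}) ` (- {0}) \<and> open {v. v \<noteq> 0 \<and> vec.span {v} \<in> T})"

lemma istopology_CP1:
  "istopology (\<lambda>T. T \<subseteq> (\<lambda>v::complex^2. vec.span {v}) ` (- {0}) \<and>
     open {v. v \<noteq> 0 \<and> vec.span {v} \<in> T})"
proof -
  have Int: "{v::complex^2. v \<noteq> 0 \<and> vec.span {v} \<in> S \<inter> T}
      = {v. v \<noteq> 0 \<and> vec.span {v} \<in> S} \<inter> {v. v \<noteq> 0 \<and> vec.span {v} \<in> T}" for S T
    by auto
  have Un: "{v::complex^2. v \<noteq> 0 \<and> vec.span {v} \<in> \<Union>K}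
      = (\<Union>S\<in>K. {v. v \<noteq> 0 \<and> vec.span {v} \<in> S})" for K
    by auto
  show ?thesis
    unfolding istopology_def Int Un
    by (intro conjI allI impI open_Int open_UN ballI) (blast+)
qed

lemma openin_CP1:
  "openin CP1 T \<longleftrightarrow> T \<subseteq> (\<lambda>v::complex^2. vec.span {v}) ` (- {0}) \<and>
     open {v. v \<noteq> 0 \<and> vec.span {v} \<in> T}"
  unfolding CP1_def by (simp add: topology_inverse' [OF istopology_CP1])

lemma topspace_CP1: "topspace CP1 = (\<lambda>v::complex^2. vec.span {v}) ` (- {0})"
proof -
  have "{v::complex^2. v \<noteq> 0 \<and> vec.span {v} \<in> (\<lambda>v. vec.span {v}) ` (- {0})} = - {0}" by auto
  then have "openin CP1 ((\<lambda>v::complex^2. vec.span {v}) ` (- {0}))"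
    by (simp add: openin_CP1 open_Compl)
  then have "(\<lambda>v::complex^2. vec.span {v}) ` (- {0}) \<subseteq> topspace CP1"
    by (rule openin_subset)
  moreover have "topspace CP1 \<subseteq> (\<lambda>v::complex^2. vec.span {v}) ` (- {0})"
    using openin_topspace [of CP1] unfolding openin_CP1 by (rule conjunct1)
  ultimately show ?thesis by (rule subset_antisym [rotated])
qed

lemma quotient_map_CP1:
  "quotient_map (top_of_set (- {0})) CP1 (\<lambda>v::complex^2. vec.span {v})"
proof -
  have "{v \<in> - {0::complex^2}. vec.span {v} \<in> T} = {v. v \<noteq> 0 \<and> vec.span {v} \<in> T}" for T by auto
  then show ?thesis
    by (simp add: quotient_map_def topspace_CP1 openin_CP1 openin_open_eq open_Compl)
qed

definition invariant_line :: "real \<times> real \<Rightarrow> (real \<times> real \<Rightarrow> complex^2^2) \<Rightarrow>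
    (real \<times> real \<Rightarrow> complex^2^2) \<Rightarrow> (real \<times> real \<Rightarrow> complex^2^2) \<Rightarrow>
    (real \<times> real \<Rightarrow> (complex^2) set) \<Rightarrow> bool" where
  "invariant_line \<tau> U1 U2 A l \<longleftrightarrow>
     continuous_map euclidean CP1 l \<and>
     (\<forall>w. l (w + e1) = (\<lambda>v. U1 w *v v) ` l w) \<and>
     (\<forall>w. l (w + e2) = (\<lambda>v. U2 w *v v) ` l w) \<and>
     (\<forall>w. (\<lambda>v. A w *v v) ` l w = l (w + \<tau>))"

definition carried_by ::
    "(real \<times> real \<Rightarrow> (complex^2) set) \<Rightarrow> (real \<times> real \<Rightarrow> complex^2) \<Rightarrow> bool" where
  "carried_by l F \<longleftrightarrow> (AE w in lebesgue. F w \<in> l w)"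

fun iterate_cocycle :: "real \<times> real \<Rightarrow> (real \<times> real \<Rightarrow> complex^2^2) \<Rightarrow> nat \<Rightarrow>
    real \<times> real \<Rightarrow> complex^2^2" where
  "iterate_cocycle \<tau> A 0 w = mat 1"
| "iterate_cocycle \<tau> A (Suc n) w = A (w + real n *\<^sub>R \<tau>) ** iterate_cocycle \<tau> A n w"

definition norm_on :: "(complex^2) set \<Rightarrow> complex^2^2 \<Rightarrow> real" where
  "norm_on l M = (SUP v\<in>{v\<in>l. norm v = 1}. norm (M *v v))"

definition conorm_on :: "(complex^2) set \<Rightarrow> complex^2^2 \<Rightarrow> real" where
  "conorm_on l M = (INF v\<in>{v\<in>l. norm v = 1}. norm (M *v v))"

definition dominated_splitting :: "real \<times> real \<Rightarrow> (real \<times> real \<Rightarrow> complex^2^2) \<Rightarrow>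
    (real \<times> real \<Rightarrow> complex^2^2) \<Rightarrow> (real \<times> real \<Rightarrow> complex^2^2) \<Rightarrow>
    (real \<times> real \<Rightarrow> (complex^2) set) \<Rightarrow> (real \<times> real \<Rightarrow> (complex^2) set) \<Rightarrow> bool" where
  "dominated_splitting \<tau> U1 U2 A ls lu \<longleftrightarrow>
     invariant_line \<tau> U1 U2 A ls \<and> invariant_line \<tau> U1 U2 A lu \<and>
     (\<forall>w. ls w \<noteq> lu w) \<and>
     (\<exists>N\<ge>1. \<exists>\<kappa>. 0 < \<kappa> \<and> \<kappa> < 1 \<and>
        (\<forall>z. norm_on (ls z) (iterate_cocycle \<tau> A N z) / conorm_on (lu z) (iterate_cocycle \<tau> A N z)
               \<le> \<kappa>\<^sup>2))"

subsection \<open>Charge, winding vector, and (H2)\<close>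

text \<open>
  The charge, the winding vector and the validity of (H2) do not depend on the unit frame \<open>e\<close> of
  the line, so they are stated for some frame.
\<close>

definition line_frame :: "(real \<times> real \<Rightarrow> complex^2^2) \<Rightarrow> (real \<times> real \<Rightarrow> complex^2^2) \<Rightarrow>
    (real \<times> real \<Rightarrow> (complex^2) set) \<Rightarrow> int \<Rightarrow> (real \<times> real \<Rightarrow> complex^2) \<Rightarrow> bool" where
  "line_frame U1 U2 l m e \<longleftrightarrow>
     continuous_on UNIV e \<and> (\<forall>w. norm (e w) = 1 \<and> e w \<in> l w) \<and>
     (\<forall>w. e (w + e1) = U1 w *v e w) \<and>
     (\<forall>w. e (w + e2) = cis (2 * pi * of_int m * fst w) *s (U2 w *v e w))"

definition has_charge :: "(real \<times> real \<Rightarrow> complex^2^2) \<Rightarrow> (real \<times> real \<Rightarrow> complex^2^2) \<Rightarrow>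
    (real \<times> real \<Rightarrow> (complex^2) set) \<Rightarrow> int \<Rightarrow> bool" where
  "has_charge U1 U2 l m \<longleftrightarrow> (\<exists>e. line_frame U1 U2 l m e)"

definition hermitian_inner :: "complex^2 \<Rightarrow> complex^2 \<Rightarrow> complex" where
  "hermitian_inner u v = (\<Sum>i\<in>UNIV. cnj (u $ i) * v $ i)"

definition multiplier :: "real \<times> real \<Rightarrow> (real \<times> real \<Rightarrow> complex^2^2) \<Rightarrow>
    (real \<times> real \<Rightarrow> complex^2) \<Rightarrow> real \<times> real \<Rightarrow> complex" where
  "multiplier \<tau> A e w = hermitian_inner (e (w + \<tau>)) (A w *v e w)"

definition multiplier_phase :: "real \<times> real \<Rightarrow> (real \<times> real \<Rightarrow> complex^2^2) \<Rightarrow> int \<Rightarrow>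
    (real \<times> real \<Rightarrow> complex^2) \<Rightarrow> real \<times> real \<Rightarrow> complex" where
  "multiplier_phase \<tau> A m e w =
     multiplier \<tau> A e w / of_real (norm (multiplier \<tau> A e w))
       * cis (2 * pi * of_int m * fst \<tau> * snd w)"

definition phase_lift :: "real \<times> real \<Rightarrow> (real \<times> real \<Rightarrow> complex^2^2) \<Rightarrow>
    (real \<times> real \<Rightarrow> complex^2^2) \<Rightarrow> (real \<times> real \<Rightarrow> complex^2^2) \<Rightarrow>
    (real \<times> real \<Rightarrow> (complex^2) set) \<Rightarrow> int \<times> int \<Rightarrow> (real \<times> real \<Rightarrow> real) \<Rightarrow> bool" where
  "phase_lift \<tau> U1 U2 A l k g \<longleftrightarrow>
     continuous_on UNIV g \<and> periodic2 g \<and>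
     (\<exists>m e. line_frame U1 U2 l m e \<and>
        (\<forall>w. multiplier_phase \<tau> A m e w =
           cis (2 * pi * (of_int (fst k) * fst w + of_int (snd k) * snd w + g w))))"

definition has_winding :: "real \<times> real \<Rightarrow> (real \<times> real \<Rightarrow> complex^2^2) \<Rightarrow>
    (real \<times> real \<Rightarrow> complex^2^2) \<Rightarrow> (real \<times> real \<Rightarrow> complex^2^2) \<Rightarrow>
    (real \<times> real \<Rightarrow> (complex^2) set) \<Rightarrow> int \<times> int \<Rightarrow> bool" where
  "has_winding \<tau> U1 U2 A l k \<longleftrightarrow> (\<exists>g. phase_lift \<tau> U1 U2 A l k g)"

definition H2 :: "real \<times> real \<Rightarrow> (real \<times> real \<Rightarrow> complex^2^2) \<Rightarrow>
    (real \<times> real \<Rightarrow> complex^2^2) \<Rightarrow> (real \<times> real \<Rightarrow> complex^2^2) \<Rightarrow>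
    (real \<times> real \<Rightarrow> (complex^2) set) \<Rightarrow> bool" where
  "H2 \<tau> U1 U2 A l \<longleftrightarrow>
     (\<exists>k g. phase_lift \<tau> U1 U2 A l k g \<and>
        (\<exists>v. v \<in> borel_measurable lebesgue \<and> periodic2 v \<and>
           (AE w in lebesgue. v w - v (w + \<tau>) = g w - torus_mean g)))"

end

theory Submission
  imports Defs "HOL-Real_Asymp.Real_Asymp"
begin

text \<open>
  The bundle is a sum of a trivial line and a line of degree one, in
  the sewing \<open>U\<^sub>1 = 1\<close>, \<open>U\<^sub>2 = diag(1, exp(-2\<pi>i w\<^sub>1))\<close>, and the cocycle is diagonal,
  \<open>A(w) = diag(exp \<phi>(w\<^sub>1), exp(-6) exp(-2\<pi>i \<alpha> w\<^sub>2))\<close>.  The two coordinate axes are invariant lines.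
  Since \<open>\<bar>\<phi>\<bar> \<le> 4\<close>, the first axis dominates.  Its constant unit vector is a frame of charge zero, and in
  this frame the multiplier \<open>exp \<phi>\<close> is real and positive, so the winding vector and the phase \<open>g\<close>
  vanish and (H2) holds with \<open>v = 0\<close>.
  Hypothesis (H2) controls only the phase of the multiplier; the obstruction sits in its modulus.

  An eigensection carried by the first axis is a measurable \<open>\<int>\<^sup>2\<close>-periodic function \<open>f\<close> with
  \<open>exp(\<phi>(w\<^sub>1)) f(w) = c f(w + \<tau>)\<close>, which amounts to a measurable transfer function
  \<open>log \<bar>f\<bar>\<close> for \<open>\<phi>\<close> minus a constant.  The lacunary series \<open>\<phi>(x) = \<Sum>\<^sub>k 2 \<sqdot> 2\<^bsup>-q\<^sub>k\<^esup> cos(2\<pi> q\<^sub>k x)\<close> and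
  the vector \<open>\<tau> = (\<alpha>, \<beta>)\<close>, with \<open>\<alpha> = \<Sum>\<^sub>j 1/q\<^sub>j\<close> and \<open>\<beta>\<close> the same sum over even \<open>j\<close>, are built from
  the same integers \<open>q\<^sub>0 = 1\<close>, \<open>q\<^sub>k\<^sub>+\<^sub>1 = 8\<^bsup>q\<^sub>k\<^esup>\<close> so that no such function exists:

  \<^item> After the time \<open>M = 2\<^bsup>q\<^sub>k\<^esup>\<close>, a multiple of \<open>q\<^sub>k\<close>, the translation by \<open>M \<tau>\<close> is the translation
    by a vector of length about \<open>M/q\<^sub>k\<^sub>+\<^sub>1 = 4\<^bsup>-q\<^sub>k\<^esup>\<close> modulo \<open>\<int>\<^sup>2\<close>.  Translations act continuously in
    measure, so along a subsequence \<open>f(w + M \<tau>) \<rightarrow> f(w)\<close> almost everywhere, and the same is true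
    with \<open>w\<close> moved by a further vector that tends to zero (\<open>translations_tendsto_AE_subseq\<close>).
  \<^item> In the Birkhoff sum of length \<open>M\<close>, replacing \<open>\<alpha>\<close> by its truncation with denominator \<open>q\<^sub>k\<close> costs
    only \<open>O(M\<^sup>2/q\<^sub>k\<^sub>+\<^sub>1)\<close>.  For the truncation the frequencies below \<open>q\<^sub>k\<close> cancel over full periods,
    and comparison with the point half a period \<open>1/(2 q\<^sub>k)\<close> further on removes the frequencies above
    \<open>q\<^sub>k\<close>.  The amplitude \<open>2\<^bsup>-q\<^sub>k\<^esup>\<close> is chosen to balance \<open>M\<close>, and what is left is exactly
    \<open>4 cos(2\<pi> q\<^sub>k x)\<close> (\<open>birkhoff_jump_rational\<close>, \<open>birkhoff_jump\<close>).

  If \<open>f(w) \<noteq> 0\<close>, comparing the iterated eigenvalue equation at \<open>w\<close> and half a period further on gives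
  \<open>cos(2\<pi> q\<^sub>k w\<^sub>1) \<rightarrow> 0\<close>, and starting a quarter of a period later gives \<open>sin(2\<pi> q\<^sub>k w\<^sub>1) \<rightarrow> 0\<close>,
  contradicting \<open>cos\<^sup>2 + sin\<^sup>2 = 1\<close> (\<open>no_measurable_eigenfunction\<close>).  The unknown constant \<open>c\<close>
  drops out because only ratios of the equation at different points are used.
\<close>

section \<open>A Liouville vector with super-exponentially growing denominators\<close>

text \<open>
  The integers \<open>q\<^sub>k\<close> of the introduction are recorded through their exponents: every \<open>q\<^sub>k\<close> is a power
  of two, which gives \<open>2 q\<^sub>j dvd q\<^sub>k\<close> for \<open>j < k\<close> and \<open>q\<^sub>k dvd 2\<^bsup>q\<^sub>k\<^esup>\<close>.
\<close>

fun den_exponent :: "nat \<Rightarrow> nat" where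
  "den_exponent 0 = 0"
| "den_exponent (Suc k) = 3 * 2 ^ den_exponent k"

definition den :: "nat \<Rightarrow> nat" where "den k = 2 ^ den_exponent k"

lemma den_0: "den 0 = 1" by (simp add: den_def)

lemma den_pos [simp]: "den k > 0" by (simp add: den_def)

lemma den_neq_0 [simp]: "den k \<noteq> 0" by (simp add: den_def)

lemma den_Suc: "den (Suc k) = 8 ^ den k"
  by (simp add: den_def power_mult)

lemma den_exponent_less_Suc: "den_exponent k < den_exponent (Suc k)"
proof -
  have "den_exponent k < 2 ^ den_exponent k" by simp
  then show ?thesis unfolding den_exponent.simps by linarith
qed

lemma strict_mono_den_exponent: "strict_mono den_exponent"
  by (rule strict_monoI_Suc) (rule den_exponent_less_Suc)

lemma strict_mono_den: "strict_mono den"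
  using strict_mono_den_exponent by (auto simp: strict_mono_def den_def)

lemma den_dvd: "j \<le> k \<Longrightarrow> den j dvd den k"
  using strict_mono_den_exponent by (auto simp: den_def strict_mono_less_eq intro: le_imp_power_dvd)

lemma double_den_dvd: "j < k \<Longrightarrow> 2 * den j dvd den k"
proof -
  assume "j < k"
  then have "Suc (den_exponent j) \<le> den_exponent k" using strict_mono_den_exponent by (auto simp: strict_mono_def Suc_le_eq)
  from le_imp_power_dvd[OF this, of "2::nat"] show ?thesis by (simp add: den_def)
qed

lemma den_dvd_two_power: "den k dvd 2 ^ den k"
  unfolding den_def by (rule le_imp_power_dvd) (simp add: less_imp_le)

lemma den_add_ge: "2 ^ i * den k \<le> den (k + i)"
proof (induction i)
  case (Suc i)
  have "2 * den (k + i) dvd den (k + Suc i)" by (rule double_den_dvd) simp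
  then have "2 * den (k + i) \<le> den (k + Suc i)" by (rule dvd_imp_le) simp
  with Suc show ?case by simp
qed simp

lemma filterlim_den: "filterlim den at_top sequentially"
  by (rule filterlim_subseq [OF strict_mono_den])

definition lacunary :: "(nat \<Rightarrow> nat) \<Rightarrow> real" where
  "lacunary c = (\<Sum>j. real (c j) / real (den j))"

definition lacunary_num :: "(nat \<Rightarrow> nat) \<Rightarrow> nat \<Rightarrow> nat" where
  "lacunary_num c k = (\<Sum>j\<le>k. c j * (den k div den j))"

lemma lacunary_num_over_den: "real (lacunary_num c k) / real (den k) = (\<Sum>j\<le>k. real (c j) / real (den j))"
  unfolding lacunary_num_def of_nat_sum sum_divide_distrib
  by (rule sum.cong) (use den_dvd in \<open>auto simp: real_of_nat_div\<close>)

text \<open>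
  All terms with \<open>j < k\<close> are even and the last one is \<open>1\<close>, so the fraction \<open>lacunary_num c k / den k\<close> is in lowest terms.  Hence
  the rotation by it has no shorter period, which makes lower frequencies cancel in Birkhoff sums.
\<close>

lemma odd_lacunary_num:
  assumes "c k = 1" shows "odd (lacunary_num c k)"
proof -
  have "even (\<Sum>j<k. c j * (den k div den j))"
  proof (rule dvd_sum)
    fix j assume "j \<in> {..<k}"
    then have "2 * den j dvd den k" by (simp add: double_den_dvd)
    then show "even (c j * (den k div den j))"
      by (metis dvd_mult dvd_mult_cancel2 dvd_div_iff_mult dvd_mult_right den_pos less_not_refl)
  qed
  moreover have "lacunary_num c k = (\<Sum>j<k. c j * (den k div den j)) + 1"
    unfolding lacunary_num_def by (simp add: lessThan_Suc_atMost[symmetric] assms)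
  ultimately show ?thesis by simp
qed

lemma summable_lacunary:
  assumes "\<And>j. c j \<le> 1"
  shows "summable (\<lambda>j. real (c j) / real (den j))"
proof (rule summable_comparison_test')
  show "summable (\<lambda>j. (1/2::real) ^ j)" by (simp add: summable_geometric)
  fix j :: nat
  have "2 ^ j \<le> den j" using den_add_ge[of j 0] by (simp add: den_0)
  then have "(2::real) ^ j \<le> real (den j)" by (metis of_nat_le_iff of_nat_numeral of_nat_power)
  then show "norm (real (c j) / real (den j)) \<le> (1/2) ^ j"
    using assms[of j] by (simp add: frac_le power_one_over)
qed

text \<open>
  The tail of the series is dominated by a geometric series with ratio \<open>1/2\<close> that starts at its
  first term \<open>1 / den (Suc k)\<close>.
\<close>

lemma lacunary_approx:
  assumes "\<And>j. c j \<le> 1"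
  shows "0 \<le> lacunary c - lacunary_num c k / den k" "lacunary c - lacunary_num c k / den k \<le> 2 / den (Suc k)"
proof -
  let ?t = "\<lambda>j. real (c j) / real (den j)"
  have eq: "lacunary c - lacunary_num c k / den k = (\<Sum>i. ?t (i + Suc k))"
    unfolding lacunary_def lacunary_num_over_den
    using suminf_minus_initial_segment[OF summable_lacunary[of c, OF assms], where k = "Suc k"]
    by (simp add: lessThan_Suc_atMost[symmetric])
  have s: "summable (\<lambda>i. ?t (i + Suc k))"
    by (rule summable_ignore_initial_segment[OF summable_lacunary[OF assms]])
  show "0 \<le> lacunary c - lacunary_num c k / den k"
    unfolding eq by (rule suminf_nonneg[OF s]) simp
  have g: "(\<lambda>i. (1/2::real)^i * (1 / den (Suc k))) sums (2 * (1 / den (Suc k)))"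
    using sums_mult2[OF geometric_sums[of "1/2::real"], of "1 / den (Suc k)"] by simp
  have "(\<Sum>i. ?t (i + Suc k)) \<le> 2 * (1 / den (Suc k))"
    unfolding sums_unique[OF g]
  proof (rule suminf_le[OF _ s sums_summable[OF g]])
    fix i
    have "real (2 ^ i * den (Suc k)) \<le> real (den (Suc k + i))"
      by (rule of_nat_mono, rule den_add_ge)
    then have "(2::real) ^ i * real (den (Suc k)) \<le> real (den (i + Suc k))"
      by (simp add: add.commute)
    then have "?t (i + Suc k) \<le> 1 / (2 ^ i * real (den (Suc k)))"
      using assms[of "i + Suc k"] by (intro frac_le) auto
    then show "?t (i + Suc k) \<le> (1/2::real)^i * (1 / den (Suc k))"
      by (simp add: power_one_over)
  qed
  then show "lacunary c - lacunary_num c k / den k \<le> 2 / den (Suc k)"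
    unfolding eq by simp
qed

text \<open>
  Both values occur infinitely often, which is what makes the two coordinates of \<open>tau\<close> rationally
  independent together with \<open>1\<close>.
\<close>

definition even_coeff :: "nat \<Rightarrow> nat" where "even_coeff j = (if even j then 1 else 0)"

definition tau :: "real \<times> real" where
  "tau = (lacunary (\<lambda>_. 1), lacunary even_coeff)"

lemma even_coeff_le_1: "even_coeff j \<le> 1" by (simp add: even_coeff_def)

lemma tendsto_den_ratio: "(\<lambda>k. C * real (den k) / real (den (Suc k))) \<longlonglongrightarrow> 0"
proof -
  have "(\<lambda>n::nat. C * real n / 8 ^ n) \<longlonglongrightarrow> 0" by real_asymp
  from filterlim_compose[OF this filterlim_den] show ?thesis by (simp add: den_Suc)
qed

text \<open>
  Multiplying a relation by \<open>den k\<close> and replacing both coordinates by their truncations gives an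
  integer that is smaller than one for large \<open>k\<close>, hence zero.  So the truncations satisfy the
  relation, and subtracting two consecutive truncated relations gives
  \<open>b + c \<sqdot> even_coeff (Suc k) = 0\<close> for all large \<open>k\<close> of either parity.
\<close>

lemma no_integer_relation:
  fixes a b c :: int
  assumes "of_int a + of_int b * fst tau + of_int c * snd tau = 0"
  shows "a = 0 \<and> b = 0 \<and> c = 0"
proof -
  define r :: "nat \<Rightarrow> int" where
    "r k = a * int (den k) + b * int (lacunary_num (\<lambda>_. 1) k) + c * int (lacunary_num even_coeff k)" for k
  define C where "C = 2 * (\<bar>of_int b\<bar> + \<bar>of_int c\<bar> :: real)"
  have r_small: "\<bar>of_int (r k)\<bar> \<le> C * den k / den (Suc k)" for k
  proof -
    let ?x = "fst tau - lacunary_num (\<lambda>_. 1) k / den k" and ?y = "snd tau - lacunary_num even_coeff k / den k"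
    have x: "\<bar>?x\<bar> \<le> 2 / den (Suc k)" and y: "\<bar>?y\<bar> \<le> 2 / den (Suc k)"
      using lacunary_approx[of "\<lambda>_. 1" k] lacunary_approx[of even_coeff k] even_coeff_le_1
      by (auto simp: tau_def)
    have "real_of_int (r k) = den k * (of_int a + of_int b * (fst tau - ?x) + of_int c * (snd tau - ?y))"
      by (simp add: r_def field_simps)
    also have "\<dots> = den k * (of_int a + of_int b * fst tau + of_int c * snd tau)
        - den k * (of_int b * ?x + of_int c * ?y)"
      by (simp only: algebra_simps)
    also have "\<dots> = - (den k * (of_int b * ?x + of_int c * ?y))"
      unfolding assms by simp
    finally have "\<bar>of_int (r k)\<bar> = den k * \<bar>of_int b * ?x + of_int c * ?y\<bar>"
      by (simp add: abs_mult)
    also have "\<bar>of_int b * ?x + of_int c * ?y\<bar> \<le> \<bar>of_int b\<bar> * (2 / den (Suc k)) + \<bar>of_int c\<bar> * (2 / den (Suc k))"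
      by (rule order_trans[OF abs_triangle_ineq])
         (auto simp only: abs_mult intro!: add_mono mult_left_mono x y)
    also have "\<dots> = C / den (Suc k)" by (simp add: C_def field_simps)
    finally show ?thesis by (simp add: mult.commute)
  qed
  have "\<forall>\<^sub>F k in sequentially. C * den k / den (Suc k) < 1"
    by (rule order_tendstoD(2)[OF tendsto_den_ratio]) simp
  then obtain K where K: "\<And>k. k \<ge> K \<Longrightarrow> C * den k / den (Suc k) < 1"
    by (auto simp: eventually_sequentially)
  have r0: "real_of_int a + of_int b * (lacunary_num (\<lambda>_. 1) k / den k) + of_int c * (lacunary_num even_coeff k / den k) = 0"
    if "k \<ge> K" for k
  proof -
    have "\<bar>real_of_int (r k)\<bar> < 1" using r_small[of k] K[OF that] by linarith
    then have "r k = 0" by linarith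
    then have "real_of_int (r k) / den k = 0" by simp
    then show ?thesis by (simp add: r_def add_divide_distrib)
  qed
  have step: "of_int b + of_int c * real (even_coeff (Suc k)) = 0" if "k \<ge> K" for k
  proof -
    have "(of_int b + of_int c * real (even_coeff (Suc k))) / real (den (Suc k)) = 0"
      using r0[of k] r0[of "Suc k"] that unfolding lacunary_num_over_den
      by (simp add: algebra_simps add_divide_distrib)
    then show ?thesis by simp
  qed
  from step[of "2*K"] step[of "2*K+1"] have "b = 0" "c = 0" by (auto simp: even_coeff_def)
  with assms show ?thesis by simp
qed

lemma ergodic_tau: "ergodic_vector tau"
  unfolding ergodic_vector_def
proof (intro ballI impI)
  fix a b c :: real
  assume "a \<in> \<rat>" "b \<in> \<rat>" "c \<in> \<rat>" and rel: "a + b * fst tau + c * snd tau = 0"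
  then obtain p q p' q' p'' q'' :: int where
    *: "q > 0" "a = of_int p / of_int q" "q' > 0" "b = of_int p' / of_int q'" "q'' > 0" "c = of_int p'' / of_int q''"
    by (metis Rats_cases')
  then have p: "of_int p = a * of_int q" "of_int p' = b * of_int q'" "of_int p'' = c * of_int q''" by auto
  have "real_of_int (p * q' * q'') + of_int (p' * q * q'') * fst tau + of_int (p'' * q * q') * snd tau
      = of_int (q * q' * q'') * (a + b * fst tau + c * snd tau)"
    using p by (simp add: algebra_simps)
  also have "\<dots> = 0" using rel by simp
  finally have "p * q' * q'' = 0 \<and> p' * q * q'' = 0 \<and> p'' * q * q' = 0"
    by (rule no_integer_relation)
  with * show "a = 0 \<and> b = 0 \<and> c = 0" by auto
qed

text \<open>
  Already the frequencies \<open>(den k, 0)\<close> violate every Diophantine condition: the distance of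
  \<open>den k \<sqdot> fst tau\<close> to the integers is exponentially small in \<open>den k\<close>.
\<close>

lemma liouville_tau: "liouville_vector tau"
  unfolding liouville_vector_def
proof (intro notI, elim exE conjE)
  fix c \<nu> :: real
  assume c: "c > 0" and "\<nu> \<ge> 1" and dio: "diophantine c \<nu> tau"
  have "(\<lambda>n::nat. 2 * real n * real n powr \<nu> / 8 ^ n) \<longlonglongrightarrow> 0" by real_asymp
  from filterlim_compose[OF this filterlim_den]
  have "(\<lambda>k. 2 * real (den k) * real (den k) powr \<nu> / den (Suc k)) \<longlonglongrightarrow> 0" by (simp add: den_Suc)
  from order_tendstoD(2)[OF this c]
  obtain k where k: "2 * real (den k) * real (den k) powr \<nu> / den (Suc k) < c"
    by (auto simp: eventually_sequentially)
  have "dist_to_int (of_int (int (den k)) * fst tau + of_int 0 * snd tau)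
      \<ge> c * of_int (\<bar>int (den k)\<bar> + \<bar>0\<bar>) powr (- \<nu>)"
    using dio[unfolded diophantine_def, rule_format, of "int (den k)" 0] by (simp add: den_def)
  then have "c * real (den k) powr (- \<nu>) \<le> dist_to_int (den k * fst tau)" by simp
  also have "\<dots> \<le> dist (den k * fst tau) (real (lacunary_num (\<lambda>_. 1) k))"
    unfolding dist_to_int_def by (rule infdist_le) simp
  also have "\<dots> = den k * \<bar>fst tau - lacunary_num (\<lambda>_. 1) k / den k\<bar>"
    by (simp add: dist_real_def abs_mult[symmetric, of "real (den k)", simplified] algebra_simps)
  also have "\<dots> \<le> den k * (2 / den (Suc k))"
    using lacunary_approx[of "\<lambda>_. 1" k] by (intro mult_left_mono) (auto simp: tau_def)
  finally have "c * real (den k) powr (- \<nu>) * real (den k) powr \<nu> \<le> den k * (2 / den (Suc k)) * real (den k) powr \<nu>"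
    by (rule mult_right_mono) simp
  also have "c * real (den k) powr (- \<nu>) * real (den k) powr \<nu> = c"
    by (simp add: mult.assoc powr_add[symmetric])
  finally show False using k by (simp add: mult.assoc mult.commute mult.left_commute)
qed

section \<open>The lacunary potential and its Birkhoff sums\<close>

text \<open>
  At the frequency \<open>den k\<close> the coefficient is the inverse of the return time \<open>2 ^ den k\<close>, and it still
  decays exponentially in the frequency, which makes the Fourier series analytic in a strip.
\<close>

definition lacunary_coeff :: "nat \<Rightarrow> real" where
  "lacunary_coeff m = (if m \<in> range den then (1/2) ^ m else 0)"

definition phi :: "real \<Rightarrow> real" where
  "phi x = (\<Sum>m. 2 * lacunary_coeff m * cos (2 * pi * real m * x))"

lemma lacunary_coeff_bounds: "0 \<le> lacunary_coeff m" "lacunary_coeff m \<le> (1/2) ^ m"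
  by (auto simp: lacunary_coeff_def)

lemma summable_phi: "summable (\<lambda>m. 2 * lacunary_coeff m * cos (2 * pi * real m * x))"
proof (rule summable_comparison_test')
  show "summable (\<lambda>m. 2 * (1/2::real) ^ m)" by (simp add: summable_geometric)
  fix m :: nat
  show "norm (2 * lacunary_coeff m * cos (2 * pi * real m * x)) \<le> 2 * (1/2) ^ m"
    using mult_mono[OF lacunary_coeff_bounds(2)[of m] abs_cos_le_one[of "2 * pi * real m * x"]] lacunary_coeff_bounds(1)[of m]
    by (simp add: abs_mult)
qed

lemma phi_lipschitz: "\<bar>phi x - phi y\<bar> \<le> 16 * pi * \<bar>x - y\<bar>"
proof -
  have cos_lip: "\<bar>cos a - cos b\<bar> \<le> \<bar>a - b\<bar>" for a b :: real
  proof -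
    have "\<bar>cos a - cos b\<bar> = 2 * \<bar>sin ((a + b) / 2)\<bar> * \<bar>sin ((b - a) / 2)\<bar>"
      by (simp add: cos_diff_cos abs_mult)
    also have "\<dots> \<le> 2 * 1 * \<bar>(b - a) / 2\<bar>"
      by (intro mult_mono abs_sin_x_le_abs_x) auto
    finally show ?thesis by simp
  qed
  let ?c = "\<lambda>m. 4 * pi * \<bar>x - y\<bar> * (real (Suc m) * (1/2) ^ m)"
  have c: "?c sums (4 * pi * \<bar>x - y\<bar> * 4)"
    using sums_mult[OF geometric_deriv_sums[of "1/2::real"], of "4 * pi * \<bar>x - y\<bar>"]
    by (simp add: power2_eq_square)
  have le: "norm (2 * lacunary_coeff m * cos (2 * pi * real m * x) - 2 * lacunary_coeff m * cos (2 * pi * real m * y)) \<le> ?c m" for m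
  proof -
    have "norm (2 * lacunary_coeff m * cos (2 * pi * real m * x) - 2 * lacunary_coeff m * cos (2 * pi * real m * y))
        = 2 * lacunary_coeff m * \<bar>cos (2 * pi * real m * x) - cos (2 * pi * real m * y)\<bar>"
      using lacunary_coeff_bounds(1)[of m] by (simp add: abs_mult flip: right_diff_distrib)
    also have "\<dots> \<le> 2 * (1/2) ^ m * \<bar>2 * pi * real m * x - 2 * pi * real m * y\<bar>"
      by (intro mult_mono cos_lip) (use lacunary_coeff_bounds in auto)
    also have "\<dots> = 4 * pi * \<bar>x - y\<bar> * (real m * (1/2) ^ m)"
      by (simp add: abs_mult flip: right_diff_distrib)
    also have "\<dots> \<le> ?c m" by (intro mult_left_mono mult_right_mono) auto
    finally show ?thesis .
  qed
  have eq: "phi x - phi y = (\<Sum>m. 2 * lacunary_coeff m * cos (2 * pi * real m * x) - 2 * lacunary_coeff m * cos (2 * pi * real m * y))"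
    unfolding phi_def by (rule suminf_diff[OF summable_phi summable_phi])
  have "norm (phi x - phi y) \<le> (\<Sum>m. ?c m)"
    unfolding eq by (rule norm_suminf_le[OF le sums_summable[OF c]])
  then show ?thesis unfolding sums_unique[OF c, symmetric] by simp
qed

lemma phi_bound: "\<bar>phi x\<bar> \<le> 4"
proof -
  have s: "(\<lambda>m. 2 * (1/2::real) ^ m) sums 4"
    using sums_mult[OF geometric_sums[of "1/2::real"], of 2] by simp
  have "norm (phi x) \<le> (\<Sum>m. 2 * (1/2::real) ^ m)"
    unfolding phi_def
  proof (rule norm_suminf_le[OF _ sums_summable[OF s]])
    fix m
    show "norm (2 * lacunary_coeff m * cos (2 * pi * real m * x)) \<le> 2 * (1/2) ^ m"
      using mult_mono[OF lacunary_coeff_bounds(2)[of m] abs_cos_le_one[of "2 * pi * real m * x"]] lacunary_coeff_bounds(1)[of m]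
      by (simp add: abs_mult)
  qed
  then show ?thesis unfolding sums_unique[OF s, symmetric] by simp
qed

lemma cos_add_of_nat_pi: "cos (x + 2 * pi * real n) = cos x"
  using cos_int_2pin[of n] sin_int_2pin[of n] by (simp add: cos_add mult.commute)

lemma phi_periodic: "phi (x + 1) = phi x"
proof -
  have "cos (2 * pi * real m * (x + 1)) = cos (2 * pi * real m * x)" for m
    using cos_add_of_nat_pi[of "2 * pi * real m * x" m] by (simp add: algebra_simps)
  then show ?thesis by (simp add: phi_def)
qed

text \<open>
  The real part of a geometric sum of roots of unity.
\<close>

lemma sum_cos_full_period:
  assumes "cis \<theta> \<noteq> 1" "cis (real M * \<theta>) = 1"
  shows "(\<Sum>j<M. cos (a + real j * \<theta>)) = 0"
proof -
  have "(\<Sum>j<M. cis (a + real j * \<theta>)) = cis a * (\<Sum>j<M. cis \<theta> ^ j)"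
    unfolding sum_distrib_left by (simp only: Complex.DeMoivre cis_mult)
  also have "(\<Sum>j<M. cis \<theta> ^ j) = 0"
    using assms geometric_sum[of "cis \<theta>" M] by (simp add: Complex.DeMoivre)
  finally have "Re (\<Sum>j<M. cis (a + real j * \<theta>)) = 0" by simp
  then show ?thesis by simp
qed

text \<open>
  For the rational rotation by \<open>p/q\<close> the Fourier modes can be treated one at a time.  A mode
  \<open>m = den n\<close> with \<open>n < k\<close> sums to zero at each of the two starting points, since \<open>p\<close> odd makes
  \<open>m p / q\<close> a non-integer while \<open>q\<close> divides the length of the sum.  A mode with \<open>n > k\<close> is a multiple
  of \<open>2 q\<close> and takes the same value at \<open>x\<close> and \<open>x + 1/(2 q)\<close>.  The mode \<open>m = q\<close> is
  constant along the orbit and changes sign under the shift.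
\<close>

lemma birkhoff_jump_rational:
  fixes p k :: nat
  assumes p: "odd p"
  defines "q \<equiv> den k"
  shows "(\<Sum>j<2^q. phi (x + real j * (p / q)) - phi (x + 1 / (2 * real q) + real j * (p / q))) = 4 * cos (2 * pi * q * x)"
proof -
  have q: "q > 0" by (simp add: q_def)
  let ?y = "\<lambda>j. x + real j * (p / q)" and ?z = "\<lambda>j. x + 1 / (2 * real q) + real j * (p / q)"
  let ?t = "\<lambda>m j. 2 * lacunary_coeff m * cos (2 * pi * real m * ?y j) - 2 * lacunary_coeff m * cos (2 * pi * real m * ?z j)"
  have eq: "phi (?y j) - phi (?z j) = (\<Sum>m. ?t m j)" for j
    unfolding phi_def by (rule suminf_diff[OF summable_phi summable_phi])
  have sm: "summable (\<lambda>m. ?t m j)" for j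
    by (rule summable_diff[OF summable_phi summable_phi])
  have T0: "(\<Sum>j<2^q. ?t m j) = 0" if mq: "m \<noteq> q" for m
  proof (cases "m \<in> range den")
    case False
    then show ?thesis by (simp add: lacunary_coeff_def)
  next
    case True
    then obtain n where n: "m = den n" by auto
    consider "n < k" | "k < n" using mq n q_def by (metis linorder_neqE_nat)
    then show ?thesis
    proof cases
      case 1
      define \<theta> where "\<theta> = 2 * pi * real m * (p / q)"
      obtain l where l: "q = 2 * m * l" using double_den_dvd[OF 1] by (auto simp: q_def n)
      have "m > 0" "l > 0" using q l by (auto simp: n)
      then have th: "\<theta> = 2 * pi * (p / (2 * l))" by (simp add: \<theta>_def l)
      have "cis \<theta> \<noteq> 1"
      proof
        assume "cis \<theta> = 1"
        then have "cos \<theta> = 1" by (metis cis.simps(1) one_complex.simps(1))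
        then obtain i :: int where "\<theta> = of_int i * 2 * pi" using cos_one_2pi_int by auto
        then have "real p = of_int i * (2 * l)" using \<open>l > 0\<close> by (simp add: th field_simps)
        then have "real_of_int (int p) = real_of_int (i * (2 * int l))" by simp
        then have "int p = i * (2 * int l)" by (simp only: of_int_eq_iff)
        then have "even (int p)" by simp
        then show False using p by simp
      qed
      moreover have "cis (real (2^q) * \<theta>) = 1"
      proof -
        obtain s where "2 ^ q = q * s" using den_dvd_two_power[of k] by (auto simp: q_def)
        then have "real (2 ^ q) * \<theta> = real q * real s * (2 * pi * real m * (p / q))"
          unfolding \<theta>_def by (simp only: of_nat_mult)
        also have "\<dots> = 2 * pi * real (s * m * p)" using q by simp
        finally have "real (2 ^ q) * \<theta> = 2 * pi * real (s * m * p)" .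
        then show ?thesis using cis_multiple_2pi[of "real (s * m * p)"] by simp
      qed
      ultimately have *: "(\<Sum>j<2^q. cos (a + real j * \<theta>)) = 0" for a by (rule sum_cos_full_period)
      have "(\<Sum>j<2^q. cos (2 * pi * real m * (b + real j * (p / q)))) = 0" for b
        using *[of "2 * pi * real m * b"] by (simp add: \<theta>_def algebra_simps)
      then show ?thesis
        by (simp add: sum_subtractf flip: sum_distrib_left)
    next
      case 2
      obtain l where l: "m = 2 * q * l" using double_den_dvd[OF 2] by (auto simp: q_def n)
      have "2 * pi * real m * ?z j = 2 * pi * real m * ?y j + 2 * pi * real l" for j
        using q by (simp add: l field_simps)
      then show ?thesis by (simp add: cos_add_of_nat_pi)
    qed
  qed
  have Tq: "(\<Sum>j<2^q. ?t q j) = 4 * cos (2 * pi * q * x)"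
  proof -
    have y: "cos (2 * pi * real q * ?y j) = cos (2 * pi * q * x)" for j
    proof -
      have "2 * pi * real q * ?y j = 2 * pi * q * x + 2 * pi * real (j * p)"
        using q by (simp add: distrib_left)
      then show ?thesis by (simp only: cos_add_of_nat_pi)
    qed
    have z: "cos (2 * pi * real q * ?z j) = - cos (2 * pi * q * x)" for j
    proof -
      have "2 * pi * real q * ?z j = (2 * pi * q * x + pi) + 2 * pi * real (j * p)"
        using q by (simp add: distrib_left)
      then show ?thesis by (simp only: cos_add_of_nat_pi cos_periodic_pi)
    qed
    have "?t q j = 4 * (1/2) ^ q * cos (2 * pi * q * x)" for j
      unfolding y z by (simp add: lacunary_coeff_def q_def)
    then show ?thesis by (simp add: power_one_over)
  qed
  have "(\<Sum>j<2^q. phi (?y j) - phi (?z j)) = (\<Sum>m. \<Sum>j<2^q. ?t m j)"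
    unfolding eq by (rule suminf_sum[OF sm, symmetric])
  also have "\<dots> = (\<Sum>j<2^q. ?t q j)"
    by (subst suminf_finite[of "{q}"]) (use T0 in auto)
  finally show ?thesis unfolding Tq .
qed

definition birkhoff :: "nat \<Rightarrow> real \<Rightarrow> real" where
  "birkhoff M x = (\<Sum>j<M. phi (x + real j * fst tau))"

lemma tau_approx:
  "\<bar>fst tau - lacunary_num (\<lambda>_. 1) k / den k\<bar> \<le> 2 / 8 ^ den k"
  "\<bar>snd tau - lacunary_num even_coeff k / den k\<bar> \<le> 2 / 8 ^ den k"
  using lacunary_approx[of "\<lambda>_. 1" k] lacunary_approx[of even_coeff k] even_coeff_le_1
  by (auto simp: tau_def den_Suc)

text \<open>
  The \<open>2\<^sup>q\<close> orbit points are displaced by at most \<open>2\<^sup>q \<sqdot> 2/8\<^sup>q\<close> each, so the Lipschitz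
  bound gives an error \<open>O(4\<^sup>q/8\<^sup>q)\<close>; this is where the base \<open>8\<close> in the growth of \<open>den\<close> is needed.
\<close>

lemma birkhoff_rational_approx:
  fixes k :: nat defines "q \<equiv> den k"
  shows "\<bar>birkhoff (2^q) x - (\<Sum>j<2^q. phi (x + real j * (lacunary_num (\<lambda>_. 1) k / q)))\<bar> \<le> 32 * pi / 2 ^ q"
proof -
  let ?a = "lacunary_num (\<lambda>_. 1) k / q"
  have "\<bar>phi (x + real j * fst tau) - phi (x + real j * ?a)\<bar> \<le> 16 * pi * (2 ^ q * (2 / 8 ^ q))"
    if "j < 2 ^ q" for j
  proof -
    have "real j \<le> 2 ^ q" using that by (metis less_imp_le of_nat_le_iff of_nat_numeral of_nat_power)
    then have "\<bar>real j * (fst tau - ?a)\<bar> \<le> 2 ^ q * (2 / 8 ^ q)"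
      unfolding abs_mult q_def by (intro mult_mono tau_approx) auto
    then have "16 * pi * \<bar>(x + real j * fst tau) - (x + real j * ?a)\<bar> \<le> 16 * pi * (2 ^ q * (2 / 8 ^ q))"
      by (intro mult_left_mono) (auto simp: algebra_simps)
    with phi_lipschitz show ?thesis by (rule order_trans)
  qed
  then have "(\<Sum>j<2^q. \<bar>phi (x + real j * fst tau) - phi (x + real j * ?a)\<bar>) \<le> (\<Sum>j<(2::nat)^q. 16 * pi * (2 ^ q * (2 / 8 ^ q)))"
    by (intro sum_mono) auto
  also have "\<dots> = 32 * pi / 2 ^ q"
  proof -
    have "(8::real) ^ q = 2 ^ q * 2 ^ q * 2 ^ q" by (simp flip: power_mult_distrib)
    then show ?thesis by simp
  qed
  finally have "(\<Sum>j<2^q. \<bar>phi (x + real j * fst tau) - phi (x + real j * ?a)\<bar>) \<le> 32 * pi / 2 ^ q" .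
  from order_trans[OF sum_abs this] show ?thesis
    unfolding birkhoff_def by (simp only: sum_subtractf)
qed

lemma birkhoff_jump:
  fixes k :: nat defines "q \<equiv> den k"
  shows "\<bar>birkhoff (2^q) x - birkhoff (2^q) (x + 1 / (2 * real q)) - 4 * cos (2 * pi * q * x)\<bar> \<le> 64 * pi / 2 ^ q"
proof -
  define a where "a = real (lacunary_num (\<lambda>_. 1) k) / real q"
  define S where "S y = (\<Sum>j<2^q. phi (y + real j * a))" for y
  define x' where "x' = x + 1 / (2 * real q)"
  have odd: "odd (lacunary_num (\<lambda>_. 1) k)" by (rule odd_lacunary_num) simp
  have 1: "S x - S x' = 4 * cos (2 * pi * q * x)"
    using birkhoff_jump_rational[OF odd, where k = k and x = x]
    unfolding sum_subtractf S_def x'_def a_def q_def .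
  have 2: "\<bar>birkhoff (2^q) y - S y\<bar> \<le> 32 * pi / 2 ^ q" for y
    using birkhoff_rational_approx[where k = k and x = y] unfolding S_def a_def q_def .
  have "64 * pi / 2 ^ q = 32 * pi / 2 ^ q + 32 * pi / 2 ^ q" by simp
  with 1 2[of x] 2[of x'] show ?thesis unfolding x'_def[symmetric] by linarith
qed

text \<open>
  The power series whose value at \<open>exp(2\<pi>iz)\<close> plus value at \<open>exp(-2\<pi>iz)\<close> continues \<open>phi\<close> to a
  complex strip.  Its radius of convergence is at least two.
\<close>

definition lacunary_series :: "complex \<Rightarrow> complex" where
  "lacunary_series \<zeta> = (\<Sum>m. of_real (lacunary_coeff m) * \<zeta> ^ m)"

lemma lacunary_series_summable:
  fixes \<zeta> :: complex
  assumes "norm \<zeta> < 2"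
  shows "summable (\<lambda>m. of_real (lacunary_coeff m) * \<zeta> ^ m)"
proof (rule summable_comparison_test')
  show "summable (\<lambda>m. (norm \<zeta> / 2) ^ m)" using assms by (simp add: summable_geometric)
  fix m :: nat
  show "norm (of_real (lacunary_coeff m) * \<zeta> ^ m) \<le> (norm \<zeta> / 2) ^ m"
    using mult_right_mono[OF lacunary_coeff_bounds(2)[of m], of "norm \<zeta> ^ m"] lacunary_coeff_bounds(1)[of m]
    by (simp add: norm_mult norm_power power_divide)
qed

lemma lacunary_series_bound:
  assumes "norm \<zeta> \<le> 3/2"
  shows "norm (lacunary_series \<zeta>) \<le> 4"
proof -
  have s: "(\<lambda>m. (3/4::real) ^ m) sums 4"
    using geometric_sums[of "3/4::real"] by simp
  have "norm (lacunary_series \<zeta>) \<le> (\<Sum>m. (3/4::real) ^ m)"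
    unfolding lacunary_series_def
  proof (rule norm_suminf_le[OF _ sums_summable[OF s]])
    fix m
    have "norm (of_real (lacunary_coeff m) * \<zeta> ^ m) = lacunary_coeff m * norm \<zeta> ^ m"
      using lacunary_coeff_bounds(1)[of m] by (simp add: norm_mult norm_power)
    also have "\<dots> \<le> (1/2) ^ m * (3/2) ^ m"
      by (intro mult_mono power_mono assms lacunary_coeff_bounds) auto
    finally show "norm (of_real (lacunary_coeff m) * \<zeta> ^ m) \<le> (3/4) ^ m"
      by (simp flip: power_mult_distrib)
  qed
  then show ?thesis unfolding sums_unique[OF s, symmetric] by simp
qed

lemma lacunary_series_differentiable:
  assumes "norm \<zeta> < 2"
  shows "\<exists>D. (lacunary_series has_field_derivative D) (at \<zeta>)"
proof -
  define K :: complex where "K = of_real ((norm \<zeta> + 2) / 2)"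
  have K: "norm K < 2" "norm \<zeta> < norm K" using assms by (auto simp: K_def norm_divide simp flip: of_real_add)
  from termdiffs_strong[OF lacunary_series_summable[OF K(1)] K(2)]
  show ?thesis unfolding lacunary_series_def by blast
qed

lemma phi_eq_lacunary_series: "of_real (phi x) = lacunary_series (cis (2 * pi * x)) + lacunary_series (cis (- (2 * pi * x)))"
proof -
  have "lacunary_series (cis (2 * pi * x)) + lacunary_series (cis (- (2 * pi * x)))
     = (\<Sum>m. of_real (lacunary_coeff m) * cis (2 * pi * x) ^ m + of_real (lacunary_coeff m) * cis (- (2 * pi * x)) ^ m)"
    unfolding lacunary_series_def by (intro suminf_add lacunary_series_summable) auto
  also have "\<dots> = (\<Sum>m. of_real (2 * lacunary_coeff m * cos (2 * pi * real m * x)))"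
    by (intro arg_cong[where f = suminf] ext) (simp add: Complex.DeMoivre complex_eq_iff algebra_simps)
  also have "\<dots> = of_real (phi x)"
    unfolding phi_def by (rule suminf_of_real[OF summable_phi, symmetric])
  finally show ?thesis ..
qed

section \<open>Continuity of translations in measure\<close>

lemma AE_lebesgue_translate:
  fixes P :: "'a::euclidean_space \<Rightarrow> bool"
  assumes "AE w in lebesgue. P w"
  shows "AE w in lebesgue. P (w + h)"
proof -
  have "AE w in distr lborel borel ((+) h). P w"
    using assms by (simp only: AE_completion_iff lborel_distr_plus)
  then have "AE w in lborel. P (h + w)"
    by (rule AE_distrD[rotated]) simp
  then show ?thesis by (simp add: AE_completion_iff add.commute)
qed

text \<open>
  A Borel representative is obtained as the pointwise limit of continuous functions; having both at
  once permits integration against \<open>lborel\<close>, where translation invariance is available as an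
  equality of measures.
\<close>

lemma lebesgue_measurable_AE_limit_of_continuous:
  fixes f :: "'a::euclidean_space \<Rightarrow> 'b::euclidean_space"
  assumes "f \<in> borel_measurable lebesgue"
  obtains f' g where "f' \<in> borel_measurable borel" "AE w in lborel. f w = f' w"
    "\<And>n::nat. continuous_on UNIV (g n)" "AE w in lborel. (\<lambda>n. g n w) \<longlonglongrightarrow> f' w"
proof -
  have "f measurable_on UNIV" using lebesgue_measurable_imp_measurable_on[OF assms] by simp
  then obtain N g where N: "negligible N" and g: "\<And>n. continuous_on UNIV (g n)"
    and lim: "\<And>x. x \<notin> N \<Longrightarrow> (\<lambda>n::nat. g n x) \<longlonglongrightarrow> f x"
    by (auto simp: measurable_on_def)
  define f' where "f' x = lim (\<lambda>n. g n x)" for x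
  have "f' \<in> borel_measurable borel"
    unfolding f'_def
    by (rule borel_measurable_lim_metric) (rule borel_measurable_continuous_onI[OF g])
  moreover have ff': "f' x = f x" if "x \<notin> N" for x
    unfolding f'_def using lim[OF that] by (rule limI)
  have "AE w in lebesgue. w \<notin> N"
    using N by (simp add: negligible_iff_null_sets AE_not_in)
  then have N': "AE w in lborel. w \<notin> N" by (simp only: AE_completion_iff)
  have "AE w in lborel. f w = f' w" "AE w in lborel. (\<lambda>n. g n w) \<longlonglongrightarrow> f' w"
    using N' by (eventually_elim; use ff' lim in auto)+
  ultimately show ?thesis using that g by blast
qed

lemma integrable_indicator_cball:
  "integrable lborel (indicat_real (cball (0::'a::euclidean_space) R))"
  using emeasure_lborel_cball_finite[of "0::'a" R]
  by (intro integrable_real_indicator) (simp_all add: infinity_ennreal_def)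

lemma integrable_bounded_on_cball:
  fixes u :: "'a::euclidean_space \<Rightarrow> real"
  assumes "u \<in> borel_measurable borel" "\<And>w. \<bar>u w\<bar> \<le> 1"
  shows "integrable lborel (\<lambda>w. indicat_real (cball 0 R) w * u w)"
proof (rule Bochner_Integration.integrable_bound)
  show "integrable lborel (indicat_real (cball 0 R) :: 'a \<Rightarrow> real)"
    by (rule integrable_indicator_cball)
  show "AE w in lborel. norm (indicat_real (cball 0 R) w * u w) \<le> norm (indicat_real (cball 0 R) w)"
    using assms(2) by (auto simp: indicator_def)
  show "(\<lambda>w. indicat_real (cball 0 R) w * u w) \<in> borel_measurable lborel"
    using assms(1) by (intro borel_measurable_times borel_measurable_indicator) auto
qed

lemma lborel_integral_translate:
  fixes h :: "'a::euclidean_space \<Rightarrow> real"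
  assumes "integrable lborel h"
  shows "integrable lborel (\<lambda>w. h (c + w))" "(\<integral>w. h (c + w) \<partial>lborel) = (\<integral>w. h w \<partial>lborel)"
proof -
  have T: "(+) c \<in> measurable lborel (borel :: 'a measure)" by simp
  show "integrable lborel (\<lambda>w. h (c + w))"
    by (rule integrable_distr[OF T]) (simp only: lborel_distr_plus assms)
  have "h \<in> borel_measurable borel" using borel_measurable_integrable[OF assms] by simp
  from integral_distr[OF T this] show "(\<integral>w. h (c + w) \<partial>lborel) = (\<integral>w. h w \<partial>lborel)"
    by (simp only: lborel_distr_plus)
qed

text \<open>
  Convergence in measure on bounded sets is expressed by the integral of the truncated distance
  \<open>min 1 (norm _)\<close>, so that \<open>f\<close> may be unbounded.  The claim is clear for continuous functions by
  uniform continuity, and dominated convergence makes \<open>f\<close> close to a continuous function on a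
  ball that is larger by one, which contains the translated ball.
\<close>

lemma translation_tendsto_in_measure:
  fixes f :: "'a::euclidean_space \<Rightarrow> 'b::euclidean_space"
  assumes f: "f \<in> borel_measurable borel"
    and g: "\<And>n::nat. continuous_on UNIV (g n)" and lim: "AE w in lborel. (\<lambda>n. g n w) \<longlonglongrightarrow> f w"
    and d: "d \<longlonglongrightarrow> 0"
  shows "(\<lambda>k. \<integral>w. indicat_real (cball 0 R) w * min 1 (norm (f (w + d k) - f w)) \<partial>lborel) \<longlonglongrightarrow> 0"
proof (rule LIMSEQ_I)
  fix e :: real assume e: "e > 0"
  note [measurable] = f borel_measurable_continuous_onI[OF g]
  let ?I = "\<lambda>R. indicat_real (cball (0::'a) R)"
  let ?m = "\<lambda>x::'b. min 1 (norm x)"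
  have m3: "?m (a - b) \<le> ?m (a - x) + ?m (x - y) + ?m (y - b)" for a b x y
    using norm_triangle_ineq[of "a - x" "x - b"] norm_triangle_ineq[of "x - y" "y - b"]
    using norm_ge_zero[of "a - x"] norm_ge_zero[of "x - y"] norm_ge_zero[of "y - b"]
    by (smt (verit) diff_add_cancel add_diff_eq)
  define V where "V = measure lborel (cball (0::'a) R)"
  have V0: "V \<ge> 0" by (simp add: V_def)
  define \<epsilon> where "\<epsilon> = e / (3 + V)"
  have \<epsilon>: "\<epsilon> > 0" using e V0 by (simp add: \<epsilon>_def add_pos_nonneg)
  have int: "integrable lborel (\<lambda>w. ?I R w * ?m (u w))" if "u \<in> borel_measurable borel" for R u
    by (rule integrable_bounded_on_cball) (use that in auto)
  have "(\<lambda>n. \<integral>w. ?I (R+1) w * ?m (g n w - f w) \<partial>lborel) \<longlonglongrightarrow> (\<integral>w. 0 \<partial>(lborel :: 'a measure))"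
  proof (rule integral_dominated_convergence)
    show "integrable lborel (?I (R+1))"
      by (rule integrable_indicator_cball)
    show "AE w in lborel. (\<lambda>n. ?I (R+1) w * ?m (g n w - f w)) \<longlonglongrightarrow> 0"
      using lim
    proof eventually_elim
      case (elim w)
      then have "(\<lambda>n. g n w - f w) \<longlonglongrightarrow> 0" by (simp add: LIM_zero)
      then have "(\<lambda>n. ?I (R+1) w * min 1 (norm (g n w - f w))) \<longlonglongrightarrow> ?I (R+1) w * min 1 (norm (0::'b))"
        by (intro tendsto_intros)
      then show ?case by simp
    qed
  qed (auto simp: indicator_def)
  then have "\<forall>\<^sub>F n in sequentially. (\<integral>w. ?I (R+1) w * ?m (g n w - f w) \<partial>lborel) < \<epsilon>"
    using \<epsilon> by (intro order_tendstoD) auto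
  then obtain n where n: "(\<integral>w. ?I (R+1) w * ?m (g n w - f w) \<partial>lborel) < \<epsilon>"
    by (auto simp: eventually_sequentially)
  have "uniformly_continuous_on (cball 0 (R+1)) (g n)"
    by (rule compact_uniformly_continuous) (auto intro: continuous_on_subset[OF g])
  then obtain \<delta> where \<delta>: "\<delta> > 0" and uc: "\<And>x y. x \<in> cball 0 (R+1) \<Longrightarrow> y \<in> cball 0 (R+1) \<Longrightarrow>
      dist y x < \<delta> \<Longrightarrow> dist (g n y) (g n x) < \<epsilon>"
    using \<epsilon> by (elim uniformly_continuous_onE) blast+
  have "0 < min 1 \<delta>" using \<delta> by simp
  from LIMSEQ_D[OF d this] obtain K where K: "\<And>k. k \<ge> K \<Longrightarrow> norm (d k) < min 1 \<delta>"
    unfolding diff_zero by blast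
  have "(\<integral>w. ?I R w * ?m (f (w + d k) - f w) \<partial>lborel) < e" if "k \<ge> K" for k
  proof -
    have dk: "norm (d k) < 1" "norm (d k) < \<delta>" using K[OF that] by auto
    let ?h = "\<lambda>w. ?I (R+1) w * ?m (g n w - f w)"
    define h where "h = ?h"
    have ih: "integrable lborel h" unfolding h_def by (rule int) measurable
    have iI: "integrable lborel (\<lambda>w. ?I R w * \<epsilon>)"
      by (intro integrable_mult_left integrable_indicator_cball)
    have trans: "(\<integral>w. h (d k + w) \<partial>lborel) = (\<integral>w. h w \<partial>lborel)"
      by (rule lborel_integral_translate(2)[OF ih])
    have ih': "integrable lborel (\<lambda>w. h (d k + w))"
      by (rule lborel_integral_translate(1)[OF ih])
    have pw: "?I R w * ?m (f (w + d k) - f w) \<le> h (d k + w) + ?I R w * \<epsilon> + h w" for w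
    proof (cases "w \<in> cball 0 R")
      case True
      then have w: "w \<in> cball 0 (R+1)" "d k + w \<in> cball 0 (R+1)"
        using norm_triangle_ineq[of "d k" w] dk by auto
      have "?m (g n (d k + w) - g n w) \<le> \<epsilon>"
        using uc[OF w] dk by (simp add: dist_norm min.coboundedI2)
      then show ?thesis
        unfolding h_def using m3[of "f (d k + w)" "f w" "g n (d k + w)" "g n w"] w True
        by (simp add: norm_minus_commute add.commute)
    qed (simp add: h_def indicator_def)
    have "(\<integral>w. ?I R w * ?m (f (w + d k) - f w) \<partial>lborel) \<le> (\<integral>w. h (d k + w) + ?I R w * \<epsilon> + h w \<partial>lborel)"
    proof (rule integral_mono)
      show "integrable lborel (\<lambda>w. ?I R w * ?m (f (w + d k) - f w))" by (rule int) measurable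
      show "integrable lborel (\<lambda>w. h (d k + w) + ?I R w * \<epsilon> + h w)"
        by (rule Bochner_Integration.integrable_add[OF Bochner_Integration.integrable_add[OF ih' iI] ih])
    qed (rule pw)
    also have "\<dots> = (\<integral>w. h (d k + w) \<partial>lborel) + V * \<epsilon> + (\<integral>w. h w \<partial>lborel)"
      unfolding Bochner_Integration.integral_add[OF Bochner_Integration.integrable_add[OF ih' iI] ih]
        Bochner_Integration.integral_add[OF ih' iI] by (simp add: V_def)
    also have "\<dots> < \<epsilon> + V * \<epsilon> + \<epsilon>" unfolding trans using n by (simp add: h_def)
    also have "\<dots> \<le> (3 + V) * \<epsilon>" using \<epsilon> by (simp add: algebra_simps)
    also have "\<dots> = e" using V0 by (simp add: \<epsilon>_def)
    finally show ?thesis .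
  qed
  moreover have "0 \<le> (\<integral>w. ?I R w * ?m (f (w + d k) - f w) \<partial>lborel)" for k
    by (rule Bochner_Integration.integral_nonneg) simp
  ultimately show "\<exists>no. \<forall>k\<ge>no. norm ((\<integral>w. ?I R w * ?m (f (w + d k) - f w) \<partial>lborel) - 0) < e"
    by (intro exI[of _ K]) auto
qed

text \<open>
  Finitely many vanishing sequences of translations are handled by a single subsequence: the sum of
  their truncated distances converges to zero in \<open>L\<^sup>1\<close>.
\<close>

lemma translations_tendsto_AE_subseq:
  fixes f :: "'a::euclidean_space \<Rightarrow> 'b::euclidean_space"
  assumes f: "f \<in> borel_measurable lebesgue" and J: "finite J" and d: "\<And>i. i \<in> J \<Longrightarrow> d i \<longlonglongrightarrow> 0"
  obtains r :: "nat \<Rightarrow> nat" where "strict_mono r"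
    "AE w in lebesgue. norm w \<le> R \<longrightarrow> (\<forall>i\<in>J. (\<lambda>k. f (w + d i (r k))) \<longlonglongrightarrow> f w)"
proof -
  obtain f' g where f': "f' \<in> borel_measurable borel" and ff': "AE w in lborel. f w = f' w"
    and g: "\<And>n::nat. continuous_on UNIV (g n)" and lim: "AE w in lborel. (\<lambda>n. g n w) \<longlonglongrightarrow> f' w"
    by (rule lebesgue_measurable_AE_limit_of_continuous[OF f]) blast
  note [measurable] = f'
  let ?v = "\<lambda>i k w. indicat_real (cball 0 R) w * min 1 (norm (f' (w + d i k) - f' w))"
  let ?u = "\<lambda>k w. \<Sum>i\<in>J. ?v i k w"
  have int: "integrable lborel (?v i k)" for i k
    by (rule integrable_bounded_on_cball) auto
  have nn: "0 \<le> ?v i k w" for i k w by simp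
  have "(\<lambda>k. \<Sum>i\<in>J. \<integral>w. ?v i k w \<partial>lborel) \<longlonglongrightarrow> (\<Sum>i\<in>J. 0)"
    by (intro tendsto_sum translation_tendsto_in_measure[OF f' g lim] d)
  moreover have "norm (?u k w) = ?u k w" for k w
    using sum_nonneg[of J "\<lambda>i. ?v i k w", OF nn] by simp
  ultimately have lim0: "(\<lambda>k. \<integral>w. norm (?u k w) \<partial>lborel) \<longlonglongrightarrow> 0"
    by (simp only: Bochner_Integration.integral_sum[OF int] sum.neutral_const)
  have "integrable lborel (?u k)" for k
    by (rule Bochner_Integration.integrable_sum) (rule int)
  from tendsto_L1_AE_subseq[OF this lim0]
  obtain r :: "nat \<Rightarrow> nat" where r: "strict_mono r" "AE w in lborel. (\<lambda>n. ?u (r n) w) \<longlonglongrightarrow> 0"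
    by blast
  have tr: "AE w in lborel. \<forall>n. \<forall>i\<in>J. f (w + d i n) = f' (w + d i n)"
  proof -
    have "AE w in lborel. f (w + d i n) = f' (w + d i n)" for i n
      using AE_lebesgue_translate[of "\<lambda>w. f w = f' w" "d i n"] ff' by (simp only: AE_completion_iff)
    then show ?thesis
      unfolding AE_all_countable AE_ball_countable[OF countable_finite[OF J]] by blast
  qed
  have "AE w in lborel. norm w \<le> R \<longrightarrow> (\<forall>i\<in>J. (\<lambda>k. f (w + d i (r k))) \<longlonglongrightarrow> f w)"
    using r(2) tr ff'
  proof eventually_elim
    case (elim w)
    show ?case
    proof (intro impI ballI)
      fix i assume w: "norm w \<le> R" and i: "i \<in> J"
      have "(\<lambda>n. ?v i (r n) w) \<longlonglongrightarrow> 0"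
        by (rule tendsto_sandwich[OF _ _ tendsto_const elim(1)])
           (intro always_eventually allI nn member_le_sum[OF i] J)+
      with w have m0: "(\<lambda>n. min 1 (norm (f' (w + d i (r n)) - f' w))) \<longlonglongrightarrow> 0" by simp
      then have "\<forall>\<^sub>F n in sequentially. min 1 (norm (f' (w + d i (r n)) - f' w)) < 1"
        by (rule order_tendstoD) simp
      then have "\<forall>\<^sub>F n in sequentially. min 1 (norm (f' (w + d i (r n)) - f' w)) = norm (f' (w + d i (r n)) - f' w)"
        by eventually_elim auto
      from Lim_transform_eventually[OF m0 this]
      have "(\<lambda>n. f' (w + d i (r n))) \<longlonglongrightarrow> f' w"
        by (simp add: tendsto_norm_zero_iff LIM_zero_iff)
      with elim i show "(\<lambda>n. f (w + d i (r n))) \<longlonglongrightarrow> f w" by simp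
    qed
  qed
  with r(1) show ?thesis by (intro that) (simp_all only: AE_completion_iff)
qed

section \<open>Absence of measurable eigenfunctions\<close>

text \<open>
  Two points at which the iterated eigenvalue equation holds with the same right-hand constant
  \<open>c k\<close>: comparing the two equations eliminates that constant, and the values of the eigenfunction that
  remain all tend to the same nonzero limit.
\<close>

lemma exponent_difference_tendsto_0:
  fixes u v u' v' c :: "nat \<Rightarrow> complex" and B B' :: "nat \<Rightarrow> real"
  assumes F: "F \<noteq> 0" and u: "u \<longlonglongrightarrow> F" and v: "v \<longlonglongrightarrow> F" and u': "u' \<longlonglongrightarrow> F" and v': "v' \<longlonglongrightarrow> F"
    and eq: "\<And>k. of_real (exp (B k)) * u k = c k * v k" "\<And>k. of_real (exp (B' k)) * u' k = c k * v' k"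
  shows "(\<lambda>k. B k - B' k) \<longlonglongrightarrow> 0"
proof -
  \<comment> \<open>The constants \<open>c k\<close> may vanish, so the equations are cross-multiplied, not divided.\<close>
  have nz: "\<forall>\<^sub>F k in sequentially. u k * v' k \<noteq> 0"
    by (rule tendsto_imp_eventually_ne[OF tendsto_mult[OF u v']]) (use F in simp)
  have "exp (B k - B' k) = norm (u' k * v k / (u k * v' k))" if "u k * v' k \<noteq> 0" for k
  proof -
    have "of_real (exp (B k)) * (u k * v' k) = of_real (exp (B' k)) * (u' k * v k)"
      using eq[of k] by (metis mult.assoc mult.commute)
    then have "norm (of_real (exp (B k)) * (u k * v' k)) = norm (of_real (exp (B' k)) * (u' k * v k))"
      by (rule arg_cong)
    then show ?thesis using that by (simp add: norm_mult norm_divide exp_diff field_simps)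
  qed
  with nz have ev: "\<forall>\<^sub>F k in sequentially. norm (u' k * v k / (u k * v' k)) = exp (B k - B' k)"
    by (auto elim: eventually_mono)
  have "(\<lambda>k. norm (u' k * v k / (u k * v' k))) \<longlonglongrightarrow> norm (F * F / (F * F))"
    by (intro tendsto_intros u v u' v') (use F in simp)
  with F have "(\<lambda>k. norm (u' k * v k / (u k * v' k))) \<longlonglongrightarrow> 1" by simp
  from tendsto_ln[OF Lim_transform_eventually[OF this ev]]
  show ?thesis by simp
qed

text \<open>
  The four points \<open>w + s i k\<close> with \<open>i < 4\<close> lie a quarter of a period of \<open>cos (2 * pi * den k * _)\<close>
  apart.  Each of them is compared with its image after the return time \<open>M k\<close>, so eight vanishing
  sequences of translations are needed: \<open>s i k\<close> and \<open>s i k + h k\<close>, where \<open>h k\<close> is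
  \<open>M k *\<^sub>R tau\<close> reduced modulo \<open>\<int>\<^sup>2\<close>.
\<close>

lemma no_measurable_eigenfunction:
  fixes f :: "real \<times> real \<Rightarrow> complex"
  assumes meas: "f \<in> borel_measurable lebesgue"
    and per1: "AE w in lebesgue. f (w + e1) = f w" and per2: "AE w in lebesgue. f (w + e2) = f w"
    and eig: "AE w in lebesgue. of_real (exp (phi (fst w))) * f w = c * f (w + tau)"
  shows "AE w in lebesgue. f w = 0"
proof -
  have iter: "AE w in lebesgue. of_real (exp (birkhoff M (fst w))) * f w = c ^ M * f (w + real M *\<^sub>R tau)" for M
  proof (induction M)
    case 0
    show ?case by (simp add: birkhoff_def)
  next
    case (Suc M)
    show ?case using Suc AE_lebesgue_translate[OF eig, of "real M *\<^sub>R tau"]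
    proof eventually_elim
      case (elim w)
      have "of_real (exp (birkhoff (Suc M) (fst w))) * f w
          = of_real (exp (phi (fst (w + real M *\<^sub>R tau)))) * (of_real (exp (birkhoff M (fst w))) * f w)"
        by (simp add: birkhoff_def exp_add mult_ac)
      also have "\<dots> = c ^ M * (of_real (exp (phi (fst (w + real M *\<^sub>R tau)))) * f (w + real M *\<^sub>R tau))"
        unfolding elim(1) by (simp only: mult_ac)
      also have "\<dots> = c ^ Suc M * f (w + real (Suc M) *\<^sub>R tau)"
        unfolding elim(2) by (simp add: algebra_simps)
      finally show ?case .
    qed
  qed
  have shift1: "AE w in lebesgue. f (w + (real n, 0)) = f w" for n
  proof (induction n)
    case (Suc n)
    show ?case using Suc AE_lebesgue_translate[OF per1, of "(real n, 0)"]
      by eventually_elim (simp add: add.assoc add.commute[of 1])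
  qed (simp flip: zero_prod_def)
  have shift2: "AE w in lebesgue. f (w + (0, real n)) = f w" for n
  proof (induction n)
    case (Suc n)
    show ?case using Suc AE_lebesgue_translate[OF per2, of "(0, real n)"]
      by eventually_elim (simp add: add.assoc add.commute[of 1])
  qed (simp flip: zero_prod_def)
  have shift: "AE w in lebesgue. f (w + (real n, real m)) = f w" for n m
    using AE_lebesgue_translate[OF shift1[of n], of "(0, real m)"] shift2[of m]
    by eventually_elim (simp add: add.assoc)
  \<comment> \<open>At the return time \<open>M k\<close> the truncations of \<open>tau\<close> contribute an integer vector, and only \<open>h k\<close> is left.\<close>
  define M where "M k = (2::nat) ^ den k" for k
  define h where "h k = real (M k) *\<^sub>R (fst tau - lacunary_num (\<lambda>_. 1) k / den k, snd tau - lacunary_num even_coeff k / den k)" for k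
  have return: "AE w in lebesgue. f (w + real (M k) *\<^sub>R tau) = f (w + h k)" for k
  proof -
    obtain l where l: "M k = den k * l" using den_dvd_two_power[of k] by (auto simp: M_def)
    have "real (M k) *\<^sub>R tau = h k + (real (l * lacunary_num (\<lambda>_. 1) k), real (l * lacunary_num even_coeff k))"
      by (simp add: h_def l prod_eq_iff field_simps)
    with AE_lebesgue_translate[OF shift, of "h k" "l * lacunary_num (\<lambda>_. 1) k" "l * lacunary_num even_coeff k"]
    show ?thesis by (simp add: add.assoc)
  qed
  have pow0: "(\<lambda>k. C / 2 ^ den k) \<longlonglongrightarrow> (0::real)" for C
  proof -
    have "(\<lambda>n::nat. C / 2 ^ n) \<longlonglongrightarrow> 0" by real_asymp
    from filterlim_compose[OF this filterlim_den] show ?thesis .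
  qed
  have h0: "h \<longlonglongrightarrow> 0"
  proof -
    have small: "(\<lambda>k. real (M k) * x k) \<longlonglongrightarrow> 0" if "\<And>k. \<bar>x k\<bar> \<le> 2 / 8 ^ den k" for x
    proof (rule Lim_null_comparison[OF always_eventually[OF allI] pow0[of 2]])
      fix k
      have "norm (real (M k) * x k) \<le> 2 ^ den k * (2 / 8 ^ den k)"
        unfolding M_def real_norm_def abs_mult by (intro mult_mono that) auto
      also have "\<dots> \<le> 2 / 2 ^ den k"
      proof -
        have "(8::real) ^ den k = 2 ^ den k * 2 ^ den k * 2 ^ den k" by (simp flip: power_mult_distrib)
        then show ?thesis by (simp add: field_simps)
      qed
      finally show "norm (real (M k) * x k) \<le> 2 / 2 ^ den k" .
    qed
    have "h \<longlonglongrightarrow> (0, 0)"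
      unfolding h_def scaleR_Pair real_scaleR_def
      by (intro tendsto_Pair small tau_approx)
    then show ?thesis by (simp add: zero_prod_def)
  qed
  define s where "s i k = (real i / (4 * real (den k)), 0 :: real)" for i k
  have s0: "s i \<longlonglongrightarrow> 0" for i
  proof -
    have "(\<lambda>n::nat. real i / (4 * real n)) \<longlonglongrightarrow> 0" by real_asymp
    from filterlim_compose[OF this filterlim_den] have "s i \<longlonglongrightarrow> (0, 0)"
      unfolding s_def by (intro tendsto_Pair tendsto_const) simp
    then show ?thesis by (simp add: zero_prod_def)
  qed
  have rel: "AE w in lebesgue. \<forall>i k. of_real (exp (birkhoff (M k) (fst (w + s i k)))) * f (w + s i k)
      = c ^ M k * f (w + (s i k + h k))"
    unfolding AE_all_countable
  proof (intro allI)
    fix i k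
    show "AE w in lebesgue. of_real (exp (birkhoff (M k) (fst (w + s i k)))) * f (w + s i k)
      = c ^ M k * f (w + (s i k + h k))"
      using AE_lebesgue_translate[OF iter[of "M k"], of "s i k"] AE_lebesgue_translate[OF return, of "s i k" k]
      by eventually_elim (simp add: add.assoc)
  qed
  \<comment> \<open>Subsequences are extracted one ball at a time; the balls exhaust the plane.\<close>
  have "AE w in lebesgue. norm w \<le> real R \<longrightarrow> f w = 0" for R :: nat
  proof -
    define d where "d = (\<lambda>(i, b) k. s i k + (if b then h k else 0))"
    have d0: "d ib \<longlonglongrightarrow> 0" for ib
      using tendsto_add[OF s0[of "fst ib"] h0] s0[of "fst ib"] by (cases ib; cases "snd ib") (auto simp: d_def)
    obtain r :: "nat \<Rightarrow> nat" where r: "strict_mono r"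
      and conv: "AE w in lebesgue. norm w \<le> real R \<longrightarrow>
        (\<forall>ib\<in>{..<4::nat} \<times> UNIV. (\<lambda>k. f (w + d ib (r k))) \<longlonglongrightarrow> f w)"
      by (rule translations_tendsto_AE_subseq[OF meas, of "{..<4::nat} \<times> UNIV" d "real R"]) (use d0 in auto)
    show ?thesis using conv rel
    proof eventually_elim
      case (elim w)
      show ?case
      proof (intro impI, rule ccontr)
        assume R: "norm w \<le> real R" and nz: "f w \<noteq> 0"
        have u: "(\<lambda>k. f (w + s i (r k))) \<longlonglongrightarrow> f w"
          and v: "(\<lambda>k. f (w + (s i (r k) + h (r k)))) \<longlonglongrightarrow> f w" if "i < 4" for i
          using elim(1)[rule_format, OF R, of "(i, False)"] elim(1)[rule_format, OF R, of "(i, True)"] that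
          by (auto simp: d_def)
        let ?B = "\<lambda>i k. birkhoff (M (r k)) (fst (w + s i (r k)))"
        have diff: "(\<lambda>k. ?B i k - ?B j k) \<longlonglongrightarrow> 0" if "i < 4" "j < 4" for i j
          by (rule exponent_difference_tendsto_0[OF nz u[OF that(1)] v[OF that(1)] u[OF that(2)] v[OF that(2)]])
             (use elim(2) in auto)
        have r_top: "filterlim r at_top sequentially" using r by (rule filterlim_subseq)
        have cos0: "(\<lambda>k. 4 * cos (2 * pi * den (r k) * (fst (w + s i (r k))))) \<longlonglongrightarrow> 0" if "i + 2 < 4" for i
        proof -
          have "(\<lambda>k. ?B i k - ?B (i + 2) k - 4 * cos (2 * pi * den (r k) * (fst (w + s i (r k))))) \<longlonglongrightarrow> 0"
          proof (rule Lim_null_comparison[OF always_eventually[OF allI] filterlim_compose[OF pow0 r_top]])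
            fix k
            have "fst (w + s (i + 2) (r k)) = fst (w + s i (r k)) + 1 / (2 * real (den (r k)))"
              by (simp add: s_def field_simps)
            then show "norm (?B i k - ?B (i + 2) k - 4 * cos (2 * pi * den (r k) * (fst (w + s i (r k))))) \<le> 64 * pi / 2 ^ den (r k)"
              using birkhoff_jump[of "r k" "fst (w + s i (r k))"] by (simp add: M_def add.assoc)
          qed
          from tendsto_diff[OF diff[of i "i+2"] this] that show ?thesis by simp
        qed
        define \<theta> where "\<theta> k = 2 * pi * den (r k) * fst w" for k
        \<comment> \<open>The pairs of points \<open>0, 2\<close> and \<open>1, 3\<close> give the cosine and, a quarter period later, the sine.\<close>
        have "(\<lambda>k. 4 * cos (\<theta> k)) \<longlonglongrightarrow> 0" using cos0[of 0] by (simp add: s_def \<theta>_def)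
        moreover have "(\<lambda>k. 4 * - sin (\<theta> k)) \<longlonglongrightarrow> 0"
        proof -
          have "2 * pi * den (r k) * (fst (w + s 1 (r k))) = \<theta> k + pi / 2" for k
            by (simp add: s_def \<theta>_def field_simps)
          then show ?thesis using cos0[of 1] by (simp add: cos_add)
        qed
        ultimately have "(\<lambda>k. (4 * cos (\<theta> k))\<^sup>2 + (4 * - sin (\<theta> k))\<^sup>2) \<longlonglongrightarrow> 0\<^sup>2 + 0\<^sup>2"
          by (intro tendsto_intros)
        moreover have "(4 * cos (\<theta> k))\<^sup>2 + (4 * - sin (\<theta> k))\<^sup>2 = 16" for k
          by (simp add: power_mult_distrib flip: distrib_left)
        ultimately show False by (simp add: LIMSEQ_const_iff)
      qed
    qed
  qed
  then have "AE w in lebesgue. \<forall>R::nat. norm w \<le> real R \<longrightarrow> f w = 0"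
    unfolding AE_all_countable by blast
  then show ?thesis by eventually_elim (metis real_arch_simple)
qed

section \<open>The split bundle and its diagonal cocycle\<close>

definition diag2 :: "complex \<Rightarrow> complex \<Rightarrow> complex^2^2" where
  "diag2 a b = (\<chi> i j. if i = j then (if i = 1 then a else b) else 0)"

lemma diag2_nth [simp]:
  "diag2 a b $ 1 $ 1 = a" "diag2 a b $ 2 $ 2 = b" "diag2 a b $ 1 $ 2 = 0" "diag2 a b $ 2 $ 1 = 0"
  by (simp_all add: diag2_def)

lemma mat2_eq_iff: "(M :: complex^2^2) = N \<longleftrightarrow>
    M $ 1 $ 1 = N $ 1 $ 1 \<and> M $ 1 $ 2 = N $ 1 $ 2 \<and> M $ 2 $ 1 = N $ 2 $ 1 \<and> M $ 2 $ 2 = N $ 2 $ 2"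
  by (auto simp: vec_eq_iff forall_2)

lemma diag2_mult [simp]: "diag2 a b ** diag2 c d = diag2 (a * c) (b * d)"
  by (simp add: mat2_eq_iff matrix_matrix_mult_def sum_2)

lemma diag2_diff: "diag2 a b - diag2 c d = diag2 (a - c) (b - d)"
  by (simp add: mat2_eq_iff)

lemma diag2_add: "diag2 a b + diag2 c d = diag2 (a + c) (b + d)"
  by (simp add: mat2_eq_iff)

lemma diag2_scaleR: "r *\<^sub>R diag2 a b = diag2 (of_real r * a) (of_real r * b)"
  by (simp add: mat2_eq_iff scaleR_conv_of_real[where 'a = complex])

lemma diag2_vec_nth [simp]: "(diag2 a b *v v) $ 1 = a * v $ 1" "(diag2 a b *v v) $ 2 = b * v $ 2"
  by (simp_all add: matrix_vector_mult_def sum_2)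

lemma diag2_axis: "diag2 a b *v axis 1 c = axis 1 (a * c)" "diag2 a b *v axis 2 c = axis 2 (b * c)"
  by (auto simp: vec_eq_iff forall_2 axis_def)

lemma diag2_one: "diag2 1 1 = mat 1"
  by (simp add: mat2_eq_iff mat_def)

lemma det_diag2: "det (diag2 a b) = a * b"
  by (simp add: det_2)

lemma trace_diag2: "trace (diag2 a b) = a + b"
  by (simp add: trace_def sum_2)

lemma unitary_diag2: "norm a = 1 \<Longrightarrow> norm b = 1 \<Longrightarrow> unitary_mat (diag2 a b)"
proof -
  assume "norm a = 1" "norm b = 1"
  then have "cnj a * a = 1" "cnj b * b = 1"
    by (simp_all add: mult.commute[of "cnj _"] flip: complex_norm_square)
  moreover have "adjoint_mat (diag2 a b) = diag2 (cnj a) (cnj b)"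
    by (simp add: mat2_eq_iff adjoint_mat_def)
  ultimately show ?thesis
    by (simp add: unitary_mat_def diag2_one[symmetric] mult.commute)
qed

lemma bounded_linear_diag2: "bounded_linear (\<lambda>p. diag2 (fst p) (snd p))"
  unfolding linear_conv_bounded_linear[symmetric]
  by (rule linearI) (simp_all add: diag2_add diag2_scaleR scaleR_conv_of_real[where 'a = complex])

lemma continuous_on_diag2:
  "continuous_on S a \<Longrightarrow> continuous_on S b \<Longrightarrow> continuous_on S (\<lambda>w. diag2 (a w) (b w))"
  using bounded_linear.continuous_on[OF bounded_linear_diag2, of S "\<lambda>w. (a w, b w)"]
  by (simp add: continuous_on_Pair)

lemma has_derivative_diag2:
  assumes "(a has_derivative a') (at x)" "(b has_derivative b') (at x)"
  shows "((\<lambda>w. diag2 (a w) (b w)) has_derivative (\<lambda>h. diag2 (a' h) (b' h))) (at x)"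
  using bounded_linear.has_derivative[OF bounded_linear_diag2 has_derivative_Pair[OF assms]] by simp

definition exp_char :: "complex \<Rightarrow> complex" where "exp_char z = exp (- (2 * pi * \<i> * z))"

lemma exp_char_deriv: "(exp_char has_field_derivative - (2 * pi * \<i>) * exp_char z) (at z)"
  unfolding exp_char_def by (auto intro!: derivative_eq_intros)

lemma exp_char_add: "exp_char (a + b) = exp_char a * exp_char b"
  by (simp add: exp_char_def exp_add[symmetric] algebra_simps)

lemma norm_exp_char: "norm (exp_char z) = exp (2 * pi * Im z)"
  by (simp add: exp_char_def)

lemma exp_char_of_real: "exp_char (of_real x) = cis (- (2 * pi * x))"
  by (simp add: exp_char_def cis_conv_exp mult_ac)

lemma exp_char_one [simp]: "exp_char 1 = 1"
  using exp_char_of_real[of 1] by (simp add: complex_eq_iff)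

lemma C1_on_planeI:
  fixes f :: "real \<times> real \<Rightarrow> 'a::real_normed_vector"
  assumes "\<And>w. (f has_derivative (\<lambda>h. fst h *\<^sub>R p w + snd h *\<^sub>R q w)) (at w)"
    and "continuous_on UNIV p" "continuous_on UNIV q"
  shows "C1_on_plane f" "partial1 f = p" "partial2 f = q"
proof -
  have "frechet_derivative f (at w) = (\<lambda>h. fst h *\<^sub>R p w + snd h *\<^sub>R q w)" for w
    using frechet_derivative_at[OF assms(1)] by metis
  then show p: "partial1 f = p" and q: "partial2 f = q"
    by (simp_all add: partial1_def partial2_def fun_eq_iff)
  have "f differentiable_on UNIV"
    using assms(1) by (auto simp: differentiable_on_def differentiable_def)
  then show "C1_on_plane f" using p q assms(2,3) by (simp add: C1_on_plane_def)
qed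

definition second_sewing :: "real \<times> real \<Rightarrow> complex^2^2" where
  "second_sewing w = diag2 1 (exp_char (of_real (fst w)))"

lemma continuous_on_exp_char:
  assumes "continuous_on S g" shows "continuous_on S (\<lambda>w. exp_char (g w))"
  unfolding exp_char_def by (intro continuous_intros assms)

lemma second_sewing_C1:
  shows "C1_on_plane second_sewing" "partial1 second_sewing = (\<lambda>w. diag2 0 (- (2 * pi * \<i>) * exp_char (of_real (fst w))))"
    "partial2 second_sewing = (\<lambda>w. 0)"
proof -
  have "((\<lambda>w. exp_char (of_real (fst w))) has_derivative (\<lambda>h. - (2 * pi * \<i>) * exp_char (of_real (fst w)) * of_real (fst h))) (at w)"
    for w :: "real \<times> real"
  proof -
    have 1: "((\<lambda>w. complex_of_real (fst w)) has_derivative (\<lambda>h. of_real (fst h))) (at w)"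
      by (auto intro!: derivative_eq_intros)
    have 2: "(exp_char has_derivative (*) (- (2 * pi * \<i>) * exp_char (of_real (fst w)))) (at (of_real (fst w)))"
      using exp_char_deriv[of "of_real (fst w)"] by (simp only: has_field_derivative_def)
    from has_derivative_compose[OF 1 2] show ?thesis .
  qed
  then have "((\<lambda>w. diag2 1 (exp_char (of_real (fst w)))) has_derivative
      (\<lambda>h. diag2 0 (- (2 * pi * \<i>) * exp_char (of_real (fst w)) * of_real (fst h)))) (at w)" for w :: "real \<times> real"
    by (intro has_derivative_diag2 has_derivative_const)
  then have d: "(second_sewing has_derivative (\<lambda>h. fst h *\<^sub>R diag2 0 (- (2 * pi * \<i>) * exp_char (of_real (fst w))) + snd h *\<^sub>R 0)) (at w)" for w
    unfolding second_sewing_def by (simp add: diag2_scaleR mult_ac)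
  have c: "continuous_on UNIV (\<lambda>w::real\<times>real. diag2 0 (- (2 * pi * \<i>) * exp_char (of_real (fst w))))"
    by (intro continuous_on_diag2 continuous_intros continuous_on_exp_char)
  from C1_on_planeI[OF d c continuous_on_const]
  show "C1_on_plane second_sewing" "partial1 second_sewing = (\<lambda>w. diag2 0 (- (2 * pi * \<i>) * exp_char (of_real (fst w))))"
    "partial2 second_sewing = (\<lambda>w. 0)" by blast+
qed

lemma const_C1:
  fixes c :: "'a::real_normed_vector"
  shows "C1_on_plane (\<lambda>w. c)" "partial1 (\<lambda>w. c) = (\<lambda>w. 0)" "partial2 (\<lambda>w. c) = (\<lambda>w. 0)"
  using C1_on_planeI[of "\<lambda>w. c" "\<lambda>w. 0" "\<lambda>w. 0"] by auto

lemma sewing_system_split_bundle: "sewing_system (\<lambda>w. mat 1) second_sewing"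
  unfolding sewing_system_def K1_def diag2_one[symmetric]
proof (intro conjI allI)
  show "continuous_on UNIV second_sewing"
    unfolding second_sewing_def by (intro continuous_on_diag2 continuous_intros continuous_on_exp_char)
qed (auto simp: second_sewing_def norm_exp_char exp_char_add intro!: unitary_diag2)

text \<open>
  The connection \<open>d + 2\<pi>i w\<^sub>2 dw\<^sub>1\<close> on the second line absorbs the derivative of its sewing factor
  \<open>exp(-2\<pi>i w\<^sub>1)\<close>; its curvature is the constant \<open>-2\<pi>i\<close>, which fixes the sign in the choice of that
  factor.
\<close>

lemma has_chern_number_split_bundle: "has_chern_number (\<lambda>w. mat 1) second_sewing 1"
proof -
  define a1 :: "real \<times> real \<Rightarrow> complex^2^2" where "a1 w = diag2 0 (2 * pi * \<i> * of_real (snd w))" for w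
  have "(a1 has_derivative (\<lambda>h. diag2 0 (2 * pi * \<i> * of_real (snd h)))) (at w)" for w
    unfolding a1_def by (rule has_derivative_diag2) (auto intro!: derivative_eq_intros)
  then have d: "(a1 has_derivative (\<lambda>h. fst h *\<^sub>R 0 + snd h *\<^sub>R diag2 0 (2 * pi * \<i>))) (at w)" for w
    by (simp add: diag2_scaleR mult_ac)
  note a1 = C1_on_planeI[OF d continuous_on_const continuous_on_const]
  let ?z = "\<lambda>w::real\<times>real. 0 :: complex^2^2"
  have z: "(0 :: complex^2^2) = diag2 0 0" by (simp add: mat2_eq_iff)
  have "connection_form (\<lambda>w. mat 1) second_sewing a1 ?z"
    unfolding connection_form_def descends_along_def const_C1 second_sewing_C1
    using a1(1) const_C1(1)
    by (auto simp: a1_def second_sewing_def z diag2_diff diag2_one[symmetric] algebra_simps)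
  moreover have "trace (curvature a1 ?z w) = - (2 * pi * \<i>)" for w
    unfolding curvature_def const_C1 a1 by (simp add: z diag2_diff diag2_add trace_diag2 a1_def)
  then have "1 = (\<i> / (2 * of_real pi)) * torus_mean (\<lambda>w. trace (curvature a1 ?z w))"
    by (simp add: torus_mean_def content_Pair field_simps)
  ultimately show ?thesis
    unfolding has_chern_number_def using second_sewing_C1(1) const_C1(1) by fastforce
qed

text \<open>
  The second entry must acquire the factor \<open>exp_char (fst tau)\<close> when \<open>w\<^sub>2\<close> grows by one, to compensate the
  shift of the sewing map along \<open>tau\<close>.  The factor \<open>exp (-6)\<close> leaves room below the lower bound
  \<open>exp (-4)\<close> of the first entry.
\<close>

definition diagonal_cocycle :: "real \<times> real \<Rightarrow> complex^2^2" where
  "diagonal_cocycle w = diag2 (exp (of_real (phi (fst w)))) (exp (-6) * exp_char (of_real (fst tau) * of_real (snd w)))"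

lemma continuous_phi: "continuous_on S phi"
proof (rule continuous_on_subset[OF _ subset_UNIV])
  have "(16 * pi)-lipschitz_on UNIV phi"
    by (rule lipschitz_onI) (use phi_lipschitz in \<open>auto simp: dist_real_def\<close>)
  then show "continuous_on UNIV phi" by (rule lipschitz_on_continuous_on)
qed

lemma K2_diagonal_cocycle: "K2 tau (\<lambda>w. mat 1) second_sewing diagonal_cocycle"
  unfolding K2_def diag2_one[symmetric]
  by (auto simp: diagonal_cocycle_def second_sewing_def phi_periodic exp_char_add distrib_left mult_ac)

lemma det_diagonal_cocycle: "det (diagonal_cocycle w) \<noteq> 0"
  by (simp add: diagonal_cocycle_def det_diag2 exp_char_def)

lemma equivariant_diagonal_cocycle: "equivariant_cocycle tau (\<lambda>w. mat 1) second_sewing diagonal_cocycle"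
  unfolding equivariant_cocycle_def
proof (intro conjI allI det_diagonal_cocycle K2_diagonal_cocycle)
  show "continuous_on UNIV diagonal_cocycle"
    unfolding diagonal_cocycle_def
    by (intro continuous_on_diag2 continuous_intros continuous_on_exp_char continuous_on_compose2[OF continuous_phi]) auto
qed

lemma holomorphic2_on_fst:
  assumes "\<And>z. z \<in> W \<Longrightarrow> \<exists>D. (f has_field_derivative D) (at (fst z))"
  shows "holomorphic2_on (\<lambda>z. f (fst z)) W"
  unfolding holomorphic2_on_def
proof
  fix z assume "z \<in> W"
  then obtain D where D: "(f has_derivative (*) D) (at (fst z))"
    using assms[OF \<open>z \<in> W\<close>] by (auto simp: has_field_derivative_def)
  have "((\<lambda>z. f (fst z)) has_derivative (\<lambda>h. D * fst h)) (at z)"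
    by (rule has_derivative_compose[where f = fst, OF _ D]) (auto intro!: derivative_eq_intros)
  then have "((\<lambda>z. f (fst z)) has_derivative (\<lambda>h. D * fst h + 0 * snd h)) (at z)" by simp
  then show "\<exists>a b. ((\<lambda>z. f (fst z)) has_derivative (\<lambda>h. a * fst h + b * snd h)) (at z)" by blast
qed

lemma holomorphic2_on_snd:
  assumes "\<And>z. z \<in> W \<Longrightarrow> \<exists>D. (f has_field_derivative D) (at (snd z))"
  shows "holomorphic2_on (\<lambda>z. f (snd z)) W"
  unfolding holomorphic2_on_def
proof
  fix z assume "z \<in> W"
  then obtain D where D: "(f has_derivative (*) D) (at (snd z))"
    using assms[OF \<open>z \<in> W\<close>] by (auto simp: has_field_derivative_def)
  have "((\<lambda>z. f (snd z)) has_derivative (\<lambda>h. D * snd h)) (at z)"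
    by (rule has_derivative_compose[where f = snd, OF _ D]) (auto intro!: derivative_eq_intros)
  then have "((\<lambda>z. f (snd z)) has_derivative (\<lambda>h. 0 * fst h + D * snd h)) (at z)" by simp
  then show "\<exists>a b. ((\<lambda>z. f (snd z)) has_derivative (\<lambda>h. a * fst h + b * snd h)) (at z)" by blast
qed

lemma strip_extends_diag2I:
  assumes W: "open W" "strip \<delta> \<subseteq> W"
    and hol: "holomorphic2_on a W" "holomorphic2_on b W"
    and bd: "\<And>z. z \<in> strip \<delta> \<Longrightarrow> norm (a z) \<le> C" "\<And>z. z \<in> strip \<delta> \<Longrightarrow> norm (b z) \<le> D"
    and M: "\<And>x y. M (x, y) = diag2 (a (of_real x, of_real y)) (b (of_real x, of_real y))"
  shows "strip_extends \<delta> M"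
  unfolding strip_extends_def
proof (intro exI conjI allI)
  let ?M = "\<lambda>z. diag2 (a z) (b z)"
  have "holomorphic2_on (\<lambda>z. 0) W"
    by (rule holomorphic2_on_fst[of W "\<lambda>z. 0"]) (rule exI[of _ 0], simp)
  then show "holomorphic2_on (\<lambda>z. ?M z $ i $ j) W" for i j
    using hol exhaust_2[of i] exhaust_2[of j] by auto
  have "bounded (a ` strip \<delta> \<times> b ` strip \<delta>)"
    by (intro bounded_Times) (auto simp: bounded_iff intro: bd)
  from bounded_linear_image[OF this bounded_linear_diag2]
  show "bounded (?M ` strip \<delta>)" by (rule bounded_subset) force
  show "?M (of_real x, of_real y) = M (x, y)" for x y by (simp add: M)
qed (use W in auto)

lemma exp_strip_bound: "x \<le> 1/20 \<Longrightarrow> exp (2 * pi * x) \<le> 3/2"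
proof -
  assume "x \<le> 1/20"
  then have "2 * pi * x \<le> 2 * pi * (1/20)" by (intro mult_left_mono) auto
  also have "\<dots> \<le> 8/25" using pi_approx by simp
  finally have "exp (2 * pi * x) \<le> exp (8/25)" by simp
  also have "\<dots> \<le> 1 + 8/25 + (8/25)\<^sup>2" by (rule exp_bound) auto
  also have "\<dots> \<le> 3/2" by (simp add: power2_eq_square)
  finally show ?thesis .
qed

definition phi_ext :: "complex \<Rightarrow> complex" where
  "phi_ext z = lacunary_series (exp_char (- z)) + lacunary_series (exp_char z)"

lemma phi_ext_of_real: "phi_ext (of_real x) = of_real (phi x)"
  unfolding phi_ext_def phi_eq_lacunary_series using exp_char_of_real[of x] exp_char_of_real[of "-x"] by simp

text \<open>
  On the strip of half-width \<open>1/20\<close> both \<open>exp(2\<pi>iz)\<close> and \<open>exp(-2\<pi>iz)\<close> stay in the disc of radius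
  \<open>3/2\<close>, well inside the disc of radius two where the power series converges.
\<close>

lemma strip_admissible_diagonal_cocycle: "strip_admissible tau (\<lambda>w. mat 1) second_sewing diagonal_cocycle"
proof -
  define W where "W = {z :: complex \<times> complex. norm (exp_char (fst z)) < 2 \<and> norm (exp_char (- fst z)) < 2}"
  have W: "open W"
    unfolding W_def by (intro open_Collect_conj open_Collect_less continuous_intros continuous_on_exp_char)
  have small: "norm (exp_char (fst z)) \<le> 3/2" "norm (exp_char (- fst z)) \<le> 3/2" if "z \<in> strip (1/20)" for z
    using that exp_strip_bound[of "Im (fst z)"] exp_strip_bound[of "- Im (fst z)"]
    by (auto simp: norm_exp_char strip_def abs_le_iff)
  have sW: "strip (1/20) \<subseteq> W" using small by (force simp: W_def)
  have chr_lin: "\<exists>D. ((\<lambda>z. exp_char (c * z)) has_field_derivative D) (at z)" for c z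
    by (rule exI, rule DERIV_chain2[OF exp_char_deriv]) (auto intro!: derivative_eq_intros)
  have one: "\<exists>D. ((\<lambda>z. 1) has_field_derivative D) (at z)" for z :: complex
    by (rule exI[of _ 0]) simp
  have ext: "\<exists>D. ((\<lambda>z. exp (phi_ext z)) has_field_derivative D) (at (fst z))" if zW: "z \<in> W" for z
  proof -
    obtain D1 D2 where D: "(lacunary_series has_field_derivative D1) (at (exp_char (fst z)))"
      "(lacunary_series has_field_derivative D2) (at (exp_char (- fst z)))"
      using zW lacunary_series_differentiable[of "exp_char (fst z)"] lacunary_series_differentiable[of "exp_char (- fst z)"]
      unfolding W_def by blast
    obtain E1 E2 where E: "(exp_char has_field_derivative E1) (at (fst z))"
      "((\<lambda>z. exp_char (- z)) has_field_derivative E2) (at (fst z))"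
      using chr_lin[of 1 "fst z"] chr_lin[of "-1" "fst z"] by auto
    have "(phi_ext has_field_derivative D2 * E2 + D1 * E1) (at (fst z))"
      unfolding phi_ext_def by (intro DERIV_add DERIV_chain2[OF D(1) E(1)] DERIV_chain2[OF D(2) E(2)])
    from DERIV_chain2[OF DERIV_exp this] show ?thesis by blast
  qed
  have U1: "strip_extends (1/20) (\<lambda>w. mat 1)"
    by (rule strip_extends_diag2I[OF W sW holomorphic2_on_fst[OF one] holomorphic2_on_fst[OF one], where C = 1 and D = 1])
       (auto simp: diag2_one)
  have U2: "strip_extends (1/20) second_sewing"
    by (rule strip_extends_diag2I[OF W sW holomorphic2_on_fst[OF one] holomorphic2_on_fst[of W "\<lambda>z. exp_char (1 * z)", OF chr_lin], where C = 1 and D = "3/2"])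
       (use small in \<open>auto simp: second_sewing_def\<close>)
  have A: "strip_extends (1/20) diagonal_cocycle"
  proof (rule strip_extends_diag2I[OF W sW holomorphic2_on_fst[OF ext] holomorphic2_on_snd])
    fix z :: "complex \<times> complex" assume z: "z \<in> strip (1/20)"
    have "Re (phi_ext (fst z)) \<le> norm (phi_ext (fst z))" by (rule complex_Re_le_cmod)
    also have "\<dots> \<le> 4 + 4"
      unfolding phi_ext_def using small[OF z]
      by (intro order_trans[OF norm_triangle_ineq] add_mono lacunary_series_bound) auto
    finally show "norm (exp (phi_ext (fst z))) \<le> exp 8" by simp
    have "fst tau * Im (snd z) \<le> \<bar>fst tau\<bar> * \<bar>Im (snd z)\<bar>"
      unfolding abs_mult[symmetric] by (rule abs_ge_self)
    also have "\<dots> \<le> \<bar>fst tau\<bar> * (1/20)"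
      by (rule mult_left_mono) (use z in \<open>simp_all add: strip_def\<close>)
    finally show "norm (exp (-6) * exp_char (of_real (fst tau) * snd z)) \<le> exp (-6) * exp (2 * pi * (\<bar>fst tau\<bar> * (1/20)))"
      by (simp add: norm_mult norm_exp_char)
  next
    fix z
    obtain D where "((\<lambda>z. exp_char (of_real (fst tau) * z)) has_field_derivative D) (at (snd z))"
      using chr_lin by blast
    from DERIV_cmult[OF this]
    show "\<exists>D. ((\<lambda>z. exp (-6) * exp_char (of_real (fst tau) * z)) has_field_derivative D) (at (snd z))" by blast
  qed (simp_all add: diagonal_cocycle_def phi_ext_of_real)
  show ?thesis
    unfolding strip_admissible_def
    using U1 U2 A sewing_system_split_bundle det_diagonal_cocycle K2_diagonal_cocycle unfolding sewing_system_def
    by (auto intro!: exI[of _ "1/20"])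
qed

definition axis_line :: "2 \<Rightarrow> (complex^2) set" where "axis_line i = vec.span {axis i 1}"

lemma norm_axis2: "norm (axis i c :: complex^2) = norm c"
  using exhaust_2[of i] by (auto simp: norm_vec_def L2_set_def sum_2 axis_def)

lemma axis_line_eq_range: "axis_line i = range (axis i)"
proof -
  have "c *s axis i 1 = axis i c" for c :: complex by (auto simp: vec_eq_iff axis_def)
  then show ?thesis unfolding axis_line_def vec.span_singleton by simp
qed

lemma axis_line_image:
  assumes "a \<noteq> 0" "b \<noteq> 0"
  shows "(\<lambda>v. diag2 a b *v v) ` axis_line i = axis_line i"
proof -
  have "axis i c \<in> (\<lambda>v. diag2 a b *v v) ` axis_line i" for c
  proof (cases "i = 1")
    case True
    with assms show ?thesis
      by (intro image_eqI[of _ _ "axis i (c / a)"]) (auto simp: axis_line_eq_range diag2_axis)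
  next
    case False
    then have "i = 2" using exhaust_2[of i] by simp
    with assms show ?thesis
      by (intro image_eqI[of _ _ "axis i (c / b)"]) (auto simp: axis_line_eq_range diag2_axis)
  qed
  moreover have "diag2 a b *v axis i c \<in> axis_line i" for c
    using exhaust_2[of i] by (auto simp: axis_line_eq_range diag2_axis)
  ultimately show ?thesis by (auto simp: axis_line_eq_range)
qed

lemma invariant_axis_line: "invariant_line tau (\<lambda>w. mat 1) second_sewing diagonal_cocycle (\<lambda>w. axis_line i)"
proof -
  have "axis_line i \<in> topspace CP1"
    unfolding topspace_CP1 axis_line_def by (intro image_eqI[of _ _ "axis i 1"]) auto
  then have "continuous_map euclidean CP1 (\<lambda>w::real\<times>real. axis_line i)" by simp
  moreover have "(\<lambda>v. second_sewing w *v v) ` axis_line i = axis_line i" "(\<lambda>v. diagonal_cocycle w *v v) ` axis_line i = axis_line i" for w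
    unfolding second_sewing_def diagonal_cocycle_def by (rule axis_line_image; simp add: exp_char_def)+
  ultimately show ?thesis by (simp add: invariant_line_def)
qed

lemma norm_on_axis_line:
  "norm_on (axis_line 2) (diag2 a b) = norm b" "conorm_on (axis_line 1) (diag2 a b) = norm a"
proof -
  have L: "{v \<in> axis_line i. norm v = 1} = axis i ` {c. norm c = 1}" for i
    by (auto simp: axis_line_eq_range norm_axis2)
  have "norm (diag2 a b *v axis 2 c) = norm b" "norm (diag2 a b *v axis 1 c) = norm a" if "norm c = 1" for c
    using that by (simp_all add: diag2_axis norm_axis2 norm_mult)
  then have *: "(\<lambda>v. norm (diag2 a b *v v)) ` {v \<in> axis_line 2. norm v = 1} = {norm b}"
     "(\<lambda>v. norm (diag2 a b *v v)) ` {v \<in> axis_line 1. norm v = 1} = {norm a}"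
    unfolding L image_image by (auto intro!: image_eqI[of _ _ 1])
  then show "norm_on (axis_line 2) (diag2 a b) = norm b" "conorm_on (axis_line 1) (diag2 a b) = norm a"
    by (simp_all add: norm_on_def conorm_on_def)
qed

lemma dominated_diagonal_cocycle:
  "dominated_splitting tau (\<lambda>w. mat 1) second_sewing diagonal_cocycle (\<lambda>w. axis_line 2) (\<lambda>w. axis_line 1)"
  unfolding dominated_splitting_def
proof (intro conjI allI invariant_axis_line)
  have "axis 1 1 \<in> axis_line 1" "axis 1 1 \<notin> axis_line 2"
    by (auto simp: axis_line_eq_range axis_eq_axis)
  then show "axis_line 2 \<noteq> axis_line 1" by blast
  have "norm_on (axis_line 2) (diagonal_cocycle z) / conorm_on (axis_line 1) (diagonal_cocycle z) \<le> (exp (-1))\<^sup>2" for z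
  proof -
    have "norm_on (axis_line 2) (diagonal_cocycle z) / conorm_on (axis_line 1) (diagonal_cocycle z) = exp (- 6) / exp (phi (fst z))"
      by (simp add: diagonal_cocycle_def norm_on_axis_line norm_mult norm_exp_char)
    also have "\<dots> = exp (- 6 - phi (fst z))" by (simp add: exp_diff)
    also have "\<dots> \<le> exp (-1 + -1)" using phi_bound[of "fst z"] by simp
    also have "\<dots> = (exp (-1))\<^sup>2" by (simp add: power2_eq_square exp_add[symmetric])
    finally show ?thesis .
  qed
  then show "\<exists>N\<ge>1. \<exists>\<kappa>. 0 < \<kappa> \<and> \<kappa> < 1 \<and> (\<forall>z. norm_on (axis_line 2) (iterate_cocycle tau diagonal_cocycle N z) /
      conorm_on (axis_line 1) (iterate_cocycle tau diagonal_cocycle N z) \<le> \<kappa>\<^sup>2)"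
    by (intro exI[of _ "1::nat"] conjI exI[of _ "exp (-1) :: real"]) (simp_all del: split_paired_All)
qed

lemma phase_lift_first_axis: "phase_lift tau (\<lambda>w. mat 1) second_sewing diagonal_cocycle (\<lambda>w. axis_line 1) (0, 0) (\<lambda>w. 0)"
  and has_charge_first_axis: "has_charge (\<lambda>w. mat 1) second_sewing (\<lambda>w. axis_line 1) 0"
proof -
  let ?e = "\<lambda>w::real\<times>real. axis 1 1 :: complex^2"
  have frame: "line_frame (\<lambda>w. mat 1) second_sewing (\<lambda>w. axis_line 1) 0 ?e"
    by (simp add: line_frame_def axis_line_eq_range norm_axis2 second_sewing_def diag2_axis)
  then show "has_charge (\<lambda>w. mat 1) second_sewing (\<lambda>w. axis_line 1) 0"
    unfolding has_charge_def by blast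
  have "multiplier tau diagonal_cocycle ?e w = of_real (exp (phi (fst w)))" for w
    by (simp add: multiplier_def hermitian_inner_def diagonal_cocycle_def sum_2 exp_of_real) (simp add: axis_def)
  then have "multiplier_phase tau diagonal_cocycle 0 ?e w = 1" for w
    by (simp add: multiplier_phase_def)
  then show "phase_lift tau (\<lambda>w. mat 1) second_sewing diagonal_cocycle (\<lambda>w. axis_line 1) (0, 0) (\<lambda>w. 0)"
    unfolding phase_lift_def using frame by (auto simp: periodic2_def intro!: exI[of _ 0] exI[of _ ?e])
qed

lemma H2_first_axis: "H2 tau (\<lambda>w. mat 1) second_sewing diagonal_cocycle (\<lambda>w. axis_line 1)"
  unfolding H2_def
  by (intro exI conjI, rule phase_lift_first_axis, rule borel_measurable_const[of 0])
     (simp_all add: periodic2_def torus_mean_def)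

theorem theorem9p13:
  shows "\<exists>(\<tau> :: real \<times> real)
            (U1 :: real \<times> real \<Rightarrow> complex^2^2) (U2 :: real \<times> real \<Rightarrow> complex^2^2)
            (A :: real \<times> real \<Rightarrow> complex^2^2)
            (ls :: real \<times> real \<Rightarrow> (complex^2) set) (lu :: real \<times> real \<Rightarrow> (complex^2) set).
     ergodic_vector \<tau> \<and> liouville_vector \<tau> \<and>
     sewing_system U1 U2 \<and> has_chern_number U1 U2 1 \<and>
     equivariant_cocycle \<tau> U1 U2 A \<and> strip_admissible \<tau> U1 U2 A \<and>
     dominated_splitting \<tau> U1 U2 A ls lu \<and>
     has_charge U1 U2 lu 0 \<and> has_winding \<tau> U1 U2 A lu (0, 0) \<and> H2 \<tau> U1 U2 A lu \<and>
     \<not> (\<exists>F. measurable_eigensection \<tau> U1 U2 A F \<and> carried_by lu F)"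
proof -
  have no: "\<not> (\<exists>F. measurable_eigensection tau (\<lambda>w. mat 1) second_sewing diagonal_cocycle F \<and> carried_by (\<lambda>w. axis_line 1) F)"
  proof
    assume "\<exists>F. measurable_eigensection tau (\<lambda>w. mat 1) second_sewing diagonal_cocycle F \<and> carried_by (\<lambda>w. axis_line 1) F"
    then obtain F c where F: "F \<in> borel_measurable lebesgue"
        "AE w in lebesgue. F (w + e1) = mat 1 *v F w" "AE w in lebesgue. F (w + e2) = second_sewing w *v F w"
        "AE w in lebesgue. diagonal_cocycle w *v F w = c *s F (w + tau)"
      and nz: "\<not> (AE w in lebesgue. F w = 0)" and carried: "AE w in lebesgue. F w \<in> axis_line 1"
      unfolding measurable_eigensection_def measurable_section_def carried_by_def by blast
    have "AE w in lebesgue. F w $ 1 = 0"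
    proof (rule no_measurable_eigenfunction)
      show "(\<lambda>w. F w $ 1) \<in> borel_measurable lebesgue"
        by (rule measurable_compose[OF F(1)])
           (intro borel_measurable_continuous_onI continuous_intros)
      show "AE w in lebesgue. F (w + e1) $ 1 = F w $ 1"
        using F(2) by eventually_elim simp
      show "AE w in lebesgue. F (w + e2) $ 1 = F w $ 1"
        using F(3) by eventually_elim (simp add: second_sewing_def)
      show "AE w in lebesgue. of_real (exp (phi (fst w))) * F w $ 1 = c * F (w + tau) $ 1"
        using F(4)
      proof eventually_elim
        case (elim w)
        then have "(diagonal_cocycle w *v F w) $ 1 = (c *s F (w + tau)) $ 1" by simp
        then show ?case by (simp add: diagonal_cocycle_def exp_of_real)
      qed
    qed
    with carried have "AE w in lebesgue. F w = 0"
      by eventually_elim (auto simp: axis_line_eq_range axis_eq_0_iff)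
    with nz show False by contradiction
  qed
  show ?thesis
    using no ergodic_tau liouville_tau sewing_system_split_bundle has_chern_number_split_bundle equivariant_diagonal_cocycle
      strip_admissible_diagonal_cocycle dominated_diagonal_cocycle has_charge_first_axis phase_lift_first_axis H2_first_axis
    unfolding has_winding_def by blast
qed

end
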